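(* Let $N\ge1$ be an integer, $p\geq2$, and $a,b\in\mathbb{R}$ with $0\leq b<\frac{N-p}{p}$, $a\leq\frac{Nb}{N-p}$ and $(p-1)a+b+1=\frac{pbN}{N-p}$. There exists a universal constant $C(N,p,a,b)>0$ such that for all $u\in C_0^\infty(\mathbb{R}^N\setminus\{0\})$, $$\left(\int_{\mathbb{R}^N}\frac{|\nabla u|^p}{|x|^{pb}}dx\right)^{\frac1p}\left(\int_{\mathbb{R}^N}\frac{|u|^p}{|x|^{pa}}dx\right)^{\frac{p-1}{p}}-\frac{N-1-(p-1)a-b}{p}\int_{\mathbb{R}^N}\frac{|u|^p}{|x|^{(p-1)a+b+1}}dx$$ $$\geq C(N,p,a,b)\inf_{c\in\mathbb{R},\,\lambda>0}\int_{\mathbb{R}^N}\frac{\left|u-ce^{-\frac{\lambda}{b+1-a}|x|^{b+1-a}}\right|^p}{|x|^{(p-1)a+b+1}}dx.$$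
   Context: $C_0^\infty(\mathbb{R}^N\setminus\{0\})$ is the space of real-valued smooth functions with compact support in $\mathbb{R}^N\setminus\{0\}$. "Universal" means that the constant depends only on $N,p,a,b$ and not on $u$. *)

theory Defs
  imports "HOL-Analysis.Analysis"
begin

definition partial_deriv :: "'n::finite \<Rightarrow> (real ^ 'n \<Rightarrow> real) \<Rightarrow> real ^ 'n \<Rightarrow> real" where
  "partial_deriv i u x = frechet_derivative u (at x) (axis i 1)"

definition grad :: "(real ^ 'n::finite \<Rightarrow> real) \<Rightarrow> real ^ 'n \<Rightarrow> real ^ 'n" where
  "grad u x = (\<chi> i. partial_deriv i u x)"

text \<open>For open \<open>S\<close>: all partial derivatives of order at most \<open>k\<close> exist and are continuous on \<open>S\<close>.\<close>

primrec Ck_on :: "nat \<Rightarrow> (real ^ 'n::finite) set \<Rightarrow> (real ^ 'n \<Rightarrow> real) \<Rightarrow> bool" where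
  "Ck_on 0 S u \<longleftrightarrow> continuous_on S u"
| "Ck_on (Suc k) S u \<longleftrightarrow>
     (\<forall>x\<in>S. u differentiable (at x)) \<and> (\<forall>i. Ck_on k S (partial_deriv i u))"

definition smooth_on :: "(real ^ 'n::finite) set \<Rightarrow> (real ^ 'n \<Rightarrow> real) \<Rightarrow> bool" where
  "smooth_on S u \<longleftrightarrow> (\<forall>k. Ck_on k S u)"

definition supp :: "(real ^ 'n::finite \<Rightarrow> real) \<Rightarrow> (real ^ 'n) set" where
  "supp u = closure {x. u x \<noteq> 0}"

text \<open>An element of \<open>C\<^sub>0\<^sup>\<infinity>(S)\<close> is represented by its extension by zero to the whole space. The
  closure in \<open>supp\<close> is taken in the whole space, so for \<open>S = - {0}\<close> such a function vanishes
  in a neighbourhood of the origin.\<close>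

definition test_functions :: "(real ^ 'n::finite) set \<Rightarrow> (real ^ 'n \<Rightarrow> real) set" where
  "test_functions S = {u. smooth_on S u \<and> compact (supp u) \<and> supp u \<subseteq> S}"

end

theory Submission
  imports Defs
begin

text \<open>
  Write \<open>M = (p - 1) a + b + 1\<close>, \<open>\<delta> = b + 1 - a\<close>, and let \<open>A\<close>, \<open>B\<close>, \<open>D\<close> be the three integrals on the left,
  so that the deficit is \<open>A\<^bsup>1/p\<^esup> B\<^bsup>(p-1)/p\<^esup> - (N - M)/p D\<close>. The hypotheses on the parameters give
  \<open>\<delta> > 0\<close>, \<open>M < N\<close> and \<open>(p - 1) \<delta> = p + p b - M\<close>.

  The additive form of the inequality comes from convexity. For \<open>\<mu> > 0\<close> compare the gradient of \<open>u\<close> with the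
  radial field \<open>Y = - \<mu> u \<bar>x\<bar>\<^bsup>\<delta>-1\<^esup> x/\<bar>x\<bar>\<close>; equality of the two characterises the multiples of
  \<open>exp (- \<mu> \<bar>x\<bar>\<^bsup>\<delta>\<^esup> / \<delta>)\<close>. Since \<open>p \<ge> 2\<close>, the function \<open>\<bar>X\<bar>\<^bsup>p\<^esup>\<close> lies above its tangent at \<open>Y\<close> by at
  least \<open>2\<^bsup>1-p\<^esup> \<bar>X - Y\<bar>\<^bsup>p\<^esup>\<close> (\<open>norm_powr_uniformly_convex\<close>). Integrated against \<open>\<bar>x\<bar>\<^bsup>-pb\<^esup>\<close>, the mixed term
  becomes a multiple of \<open>D\<close> by the divergence theorem (\<open>integral_radial_weight\<close>), and so
  \<open>A + (p - 1) \<mu>\<^bsup>p\<^esup> B - \<mu>\<^bsup>p-1\<^esup> (N - M) D\<close> bounds \<open>2\<^bsup>1-p\<^esup> \<integral> \<bar>\<nabla>u - Y\<bar>\<^bsup>p\<^esup> \<bar>x\<bar>\<^bsup>-pb\<^esup>\<close> from above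
  (\<open>ckn_deficit_lower_bound\<close>). The choice \<open>\<mu>\<^bsup>p\<^esup> = A / B\<close> turns this upper bound into \<open>p \<mu>\<^bsup>p-1\<^esup>\<close> times the
  deficit.

  With \<open>v = u exp (\<mu> \<bar>x\<bar>\<^bsup>\<delta>\<^esup> / \<delta>)\<close> the remainder is \<open>\<integral> \<bar>\<nabla>v\<bar>\<^bsup>p\<^esup> \<bar>x\<bar>\<^bsup>-pb\<^esup> exp (- \<mu> p \<bar>x\<bar>\<^bsup>\<delta>\<^esup> / \<delta>)\<close>, and the
  distance of \<open>u\<close> to the extremal family is \<open>\<integral> \<bar>v - c\<bar>\<^bsup>p\<^esup> \<bar>x\<bar>\<^bsup>-M\<^esup> exp (- \<mu> p \<bar>x\<bar>\<^bsup>\<delta>\<^esup> / \<delta>)\<close>. What remains is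
  a Poincare inequality between these two (\<open>weighted_poincare_scaled\<close>); a dilation reduces it to \<open>\<mu> = 1\<close>.

  For \<open>\<mu> = 1\<close> (\<open>weighted_poincare\<close>) the divergence theorem is applied to \<open>\<bar>v - c\<bar>\<^bsup>p\<^esup>\<close> with a radial field whose
  sign is outward near the origin and inward near infinity. Relative to the weight its divergence is bounded below by a positive
  constant both near the origin and near infinity, hence both ends are controlled by the gradient term and by
  \<open>\<integral> \<bar>v - c\<bar>\<^bsup>p\<^esup>\<close> over a ball. The ball is handled by the classical Poincare inequality
  (\<open>nn_integral_ball_poincare\<close>), which also selects \<open>c\<close>; passing from the unweighted gradient on the ball to the
  weighted one is where \<open>b \<ge> 0\<close> enters.
\<close>

section \<open>Uniform convexity of powers of the norm\<close>

text \<open>This form of convexity includes the endpoint \<open>0\<close>; it serves as Jensen's and Young's inequality below.\<close>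

lemma powr_tangent_le:
  fixes s t p :: real
  assumes p: "p \<ge> 1" and s: "0 \<le> s" and t: "0 \<le> t"
  shows "s powr p + p * s powr (p - 1) * (t - s) \<le> t powr p"
proof (cases "s = 0 \<or> t = 0")
  case True
  then show ?thesis
  proof
    assume "s = 0" then show ?thesis using p by (cases "p = 1") auto
  next
    assume "t = 0"
    then show ?thesis using p s mult_right_mono[of 1 p "s powr p"]
      by (cases "s = 0") (auto simp: powr_diff left_diff_distrib)
  qed
next
  case False
  then have s: "s > 0" and t: "t > 0" using s t by auto
  have conv: "convex_on {0<..} (\<lambda>x::real. x powr p)"
    using p by (rule powr_convex)
  have "(\<lambda>x. x powr p) t - (\<lambda>x. x powr p) s \<ge> (p * s powr (p - 1)) * (t - s)"
    by (rule convex_on_imp_above_tangent[OF conv])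
       (use s t in \<open>auto intro!: derivative_eq_intros simp: interior_open has_field_derivative_at_within\<close>)
  then show ?thesis by simp
qed

lemma powr_superadditive:
  fixes x y q :: real
  assumes q: "q \<ge> 1" and "x \<ge> 0" "y \<ge> 0"
  shows "x powr q + y powr q \<le> (x + y) powr q"
proof (cases "x + y = 0")
  case True then show ?thesis using assms by (auto simp: add_nonneg_eq_0_iff)
next
  case False
  then have xy: "x + y > 0" using assms by auto
  have *: "z powr q \<le> z * (x + y) powr (q - 1)" if "0 \<le> z" "z \<le> x + y" for z
  proof (cases "z = 0")
    case False
    then have "z powr q = z * z powr (q - 1)" using that by (simp add: powr_diff)
    also have "\<dots> \<le> z * (x + y) powr (q - 1)"
      using that q by (intro mult_left_mono powr_mono2) auto
    finally show ?thesis .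
  qed simp
  have "x powr q + y powr q \<le> (x + y) * (x + y) powr (q - 1)"
    using *[of x] *[of y] assms by (simp add: algebra_simps)
  also have "\<dots> = (x + y) powr q" using xy by (simp add: powr_diff)
  finally show ?thesis .
qed

lemma powr_mean_le:
  fixes x y q :: real
  assumes q: "q \<ge> 1" and "x \<ge> 0" "y \<ge> 0"
  shows "((x + y) / 2) powr q \<le> (x powr q + y powr q) / 2"
  using powr_tangent_le[OF q, of "(x + y)/2" x] powr_tangent_le[OF q, of "(x + y)/2" y] assms
  by (simp add: field_simps)

text \<open>With \<open>q = p / 2 \<ge> 1\<close> in the exponent of squared norms, this is superadditivity of \<open>t\<^bsup>q\<^esup>\<close>, then the
  parallelogram law, then convexity of \<open>t\<^bsup>q\<^esup>\<close>.\<close>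

lemma norm_powr_clarkson:
  fixes x y :: "'a::real_inner"
  assumes p: "p \<ge> 2"
  shows "norm ((1/2) *\<^sub>R (x + y)) powr p + norm ((1/2) *\<^sub>R (x - y)) powr p \<le> (norm x powr p + norm y powr p) / 2"
proof -
  have sq: "norm z powr p = ((norm z)\<^sup>2) powr (p / 2)" for z :: 'a
    by (cases "z = 0") (simp_all add: powr_powr flip: powr_numeral)
  have par: "(norm ((1/2) *\<^sub>R (x + y)))\<^sup>2 + (norm ((1/2) *\<^sub>R (x - y)))\<^sup>2 = ((norm x)\<^sup>2 + (norm y)\<^sup>2) / 2"
    by (simp add: power2_norm_eq_inner inner_simps inner_commute field_simps)
  have "norm ((1/2) *\<^sub>R (x + y)) powr p + norm ((1/2) *\<^sub>R (x - y)) powr p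
      \<le> ((norm ((1/2) *\<^sub>R (x + y)))\<^sup>2 + (norm ((1/2) *\<^sub>R (x - y)))\<^sup>2) powr (p / 2)"
    unfolding sq using p by (intro powr_superadditive) auto
  also have "\<dots> = (((norm x)\<^sup>2 + (norm y)\<^sup>2) / 2) powr (p / 2)"
    by (simp only: par)
  also have "\<dots> \<le> (norm x powr p + norm y powr p) / 2"
    unfolding sq using p by (intro powr_mean_le) auto
  finally show ?thesis .
qed

lemma norm_powr_tangent_le:
  fixes x y :: "'a::real_inner"
  assumes p: "p \<ge> 2"
  shows "norm y powr p + p * norm y powr (p - 2) * (y \<bullet> (x - y)) \<le> norm x powr p"
proof -
  have y: "norm y powr (p - 1) = norm y powr (p - 2) * norm y"
    using p by (cases "y = 0") (simp_all add: powr_diff power2_eq_square)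
  have "y \<bullet> (x - y) \<le> norm y * (norm x - norm y)"
    using norm_cauchy_schwarz[of y x]
    by (simp add: inner_diff_right algebra_simps power2_eq_square flip: power2_norm_eq_inner)
  then have "p * norm y powr (p - 2) * (y \<bullet> (x - y)) \<le> p * norm y powr (p - 2) * (norm y * (norm x - norm y))"
    using p by (intro mult_left_mono) auto
  also have "\<dots> = p * norm y powr (p - 1) * (norm x - norm y)"
    by (simp add: y)
  finally have "p * norm y powr (p - 2) * (y \<bullet> (x - y)) \<le> p * norm y powr (p - 1) * (norm x - norm y)" .
  moreover have "norm y powr p + p * norm y powr (p - 1) * (norm x - norm y) \<le> norm x powr p"
    using p by (intro powr_tangent_le) auto
  ultimately show ?thesis by linarith
qed

text \<open>Clarkson's inequality at the midpoint \<open>m\<close> of \<open>x\<close> and \<open>y\<close>, combined with the tangent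
  inequality between \<open>m\<close> and \<open>y\<close>: the gain \<open>\<bar>(x - y)/2\<bar>\<^bsup>p\<^esup>\<close> is doubled when the halves are cleared.\<close>

lemma norm_powr_uniformly_convex:
  fixes x y :: "'a::real_inner"
  assumes p: "p \<ge> 2"
  shows "norm y powr p + p * norm y powr (p - 2) * (y \<bullet> (x - y)) + 2 powr (1 - p) * norm (x - y) powr p
    \<le> norm x powr p"
proof -
  have 1: "norm ((1/2) *\<^sub>R (x - y)) powr p = 2 powr (- p) * norm (x - y) powr p"
  proof -
    have "norm ((1/2) *\<^sub>R (x - y)) = (1/2) * norm (x - y)" by simp
    moreover have "(1/2) powr p = 2 powr (- p)"
      using powr_divide[of 1 2 p] by (simp add: powr_minus_divide)
    ultimately show ?thesis by (simp only: powr_mult)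
  qed
  have "(1/2) *\<^sub>R y + (1/2) *\<^sub>R y = y"
    by (simp flip: scaleR_left_distrib)
  then have "(1/2) *\<^sub>R (x + y) - y = (1/2) *\<^sub>R (x + y) - ((1/2) *\<^sub>R y + (1/2) *\<^sub>R y)"
    by (simp only:)
  also have "\<dots> = (1/2) *\<^sub>R (x - y)"
    unfolding scaleR_right_distrib scaleR_diff_right by simp
  finally have mid: "(1/2) *\<^sub>R (x + y) - y = (1/2) *\<^sub>R (x - y)" .
  from norm_powr_tangent_le[OF p, of y "(1/2) *\<^sub>R (x + y)"]
  have "norm y powr p + p * norm y powr (p - 2) * (y \<bullet> (x - y)) / 2 \<le> norm ((1/2) *\<^sub>R (x + y)) powr p"
    unfolding mid by simp
  moreover have "2 powr (1 - p) = 2 * 2 powr (- p)"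
    by (simp add: powr_diff powr_minus divide_inverse)
  ultimately show ?thesis
    using norm_powr_clarkson[OF p, of x y] unfolding 1 by (simp add: mult.assoc)
qed

text \<open>Young's inequality with a free parameter, read off the tangent inequality between \<open>\<tau> A\<close> and
  \<open>\<tau>\<^bsup>-(p-1)\<^esup> B\<close> where \<open>\<tau>\<^bsup>p\<^esup> = T\<close>.\<close>

lemma young_powr:
  fixes A B T p :: real
  assumes p: "p \<ge> 2" and A: "A \<ge> 0" and B: "B \<ge> 0" and T: "T > 0"
  shows "p * A powr (p - 1) * B \<le> (p - 1) * T * A powr p + T powr (- (p - 1)) * B powr p"
proof -
  define \<tau> where "\<tau> = T powr (1 / p)"
  have \<tau>: "\<tau> > 0" "\<tau> powr p = T" using T p by (auto simp: \<tau>_def powr_powr)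
  have 1: "(\<tau> * A) powr p = T * A powr p"
    using \<tau> A by (simp add: powr_mult)
  have "(\<tau> powr (- (p - 1)) * B) powr p = (\<tau> powr (- (p - 1))) powr p * B powr p"
    by (rule powr_mult)
  also have "(\<tau> powr (- (p - 1))) powr p = (\<tau> powr p) powr (- (p - 1))"
    by (simp add: powr_powr mult.commute)
  finally have 2: "(\<tau> powr (- (p - 1)) * B) powr p = T powr (- (p - 1)) * B powr p"
    by (simp add: \<tau>)
  have "(\<tau> * A) powr (p - 1) * (\<tau> powr (- (p - 1)) * B) = A powr (p - 1) * B * (\<tau> powr (p - 1) * \<tau> powr (- (p - 1)))"
    by (simp add: powr_mult)
  also have "\<tau> powr (p - 1) * \<tau> powr (- (p - 1)) = 1"
    using \<tau> by (simp flip: powr_add)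
  finally have 3: "(\<tau> * A) powr (p - 1) * (\<tau> powr (- (p - 1)) * B) = A powr (p - 1) * B" by simp
  have 4: "(\<tau> * A) powr (p - 1) * (\<tau> * A) = (\<tau> * A) powr p"
    using \<tau> A p by (cases "A = 0") (simp_all add: powr_diff)
  have "(\<tau> * A) powr p + p * (\<tau> * A) powr (p - 1) * (\<tau> powr (- (p - 1)) * B - \<tau> * A) \<le> (\<tau> powr (- (p - 1)) * B) powr p"
    using p \<tau> A B by (intro powr_tangent_le) auto
  then have "(\<tau> * A) powr p + p * ((\<tau> * A) powr (p - 1) * (\<tau> powr (- (p - 1)) * B)) - p * ((\<tau> * A) powr (p - 1) * (\<tau> * A)) \<le> (\<tau> powr (- (p - 1)) * B) powr p"
    by (simp add: right_diff_distrib mult.assoc)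
  then have "(\<tau> * A) powr p + p * (A powr (p - 1) * B) - p * (\<tau> * A) powr p \<le> (\<tau> powr (- (p - 1)) * B) powr p"
    unfolding 3 4 .
  then show ?thesis
    unfolding 1 2 by (simp add: algebra_simps)
qed

text \<open>The derivative is written with the continuous function \<open>\<bar>w\<bar>\<^bsup>p-2\<^esup> w\<close>, which avoids a case distinction at
  zeros of \<open>u\<close>.\<close>

lemma has_real_derivative_abs_powr:
  fixes p w :: real
  assumes p: "p > 1"
  shows "((\<lambda>w. \<bar>w\<bar> powr p) has_real_derivative p * (\<bar>w\<bar> powr (p - 2) * w)) (at w)"
proof (cases "w = 0")
  case True
  have "((\<lambda>h. \<bar>h\<bar> powr (p - 1)) \<longlongrightarrow> \<bar>0\<bar> powr (p - 1)) (at (0::real))"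
    by (intro tendsto_powr' tendsto_intros) (use p in auto)
  then have *: "((\<lambda>h. \<bar>h\<bar> powr (p - 1)) \<longlongrightarrow> 0) (at (0::real))" using p by simp
  have "((\<lambda>h. \<bar>h\<bar> powr p / h) \<longlongrightarrow> 0) (at (0::real))"
  proof (rule Lim_null_comparison[OF _ *])
    have "norm (\<bar>h\<bar> powr p / h) = \<bar>h\<bar> powr (p - 1)" if "h \<noteq> 0" for h :: real
      using that by (simp add: powr_diff)
    then show "\<forall>\<^sub>F h in at (0::real). norm (\<bar>h\<bar> powr p / h) \<le> \<bar>h\<bar> powr (p - 1)"
      by (auto simp: eventually_at_filter)
  qed
  then show ?thesis
    using True by (simp add: DERIV_def)
next
  case False
  have 1: "\<bar>w\<bar> powr (p - 1) = \<bar>w\<bar> powr (p - 2) * \<bar>w\<bar>"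
    using False powr_add[of "\<bar>w\<bar>" "p - 2" 1] by simp
  have abs: "(abs has_real_derivative sgn w) (at w)"
  proof (cases "w > 0")
    case True
    have "((\<lambda>w. w) has_real_derivative sgn w) (at w)" using True by simp
    then show ?thesis
      by (rule has_field_derivative_transform_within_open[where S="{0<..}"]) (use True in auto)
  next
    case neg: False
    have "((\<lambda>w. - w) has_real_derivative sgn w) (at w)"
      using neg False by (auto intro!: derivative_eq_intros)
    then show ?thesis
      by (rule has_field_derivative_transform_within_open[where S="{..<0}"]) (use neg False in auto)
  qed
  have "((\<lambda>w. \<bar>w\<bar> powr p) has_real_derivative p * \<bar>w\<bar> powr (p - 1) * sgn w) (at w)"
    by (rule DERIV_chain'[OF abs, where g="\<lambda>x. x powr p"])
       (use False in \<open>auto intro!: derivative_eq_intros\<close>)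
  then show ?thesis
    unfolding 1 by (simp add: mult.assoc abs_mult_sgn)
qed

lemma continuous_abs_powr_times:
  fixes p :: real
  assumes p: "p \<ge> 2"
  shows "continuous_on UNIV (\<lambda>w::real. \<bar>w\<bar> powr (p - 2) * w)"
proof (cases "p = 2")
  case True
  then have "(\<lambda>w::real. \<bar>w\<bar> powr (p - 2) * w) = (\<lambda>w. w)" by auto
  then show ?thesis by (simp only: continuous_on_id)
next
  case False
  then show ?thesis using p by (intro continuous_intros continuous_on_powr') auto
qed

section \<open>Dilations and the divergence identity for radial weights\<close>

lemma nn_integral_lborel_affine:
  fixes f :: "'a::euclidean_space \<Rightarrow> ennreal"
  assumes [measurable]: "f \<in> borel_measurable borel" and c: "c > 0"
  shows "(\<integral>\<^sup>+x. f (t + c *\<^sub>R x) \<partial>lborel) = ennreal (c powr (- real DIM('a))) * (\<integral>\<^sup>+x. f x \<partial>lborel)"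
proof -
  have "(\<integral>\<^sup>+x. f x \<partial>lborel) = ennreal (c ^ DIM('a)) * (\<integral>\<^sup>+x. f (t + c *\<^sub>R x) \<partial>lborel)"
    using c by (subst lborel_affine[of c t])
      (auto simp add: nn_integral_density nn_integral_distr nn_integral_cmult)
  then have "ennreal (c powr (- real DIM('a))) * (\<integral>\<^sup>+x. f x \<partial>lborel)
      = (ennreal (c powr (- real DIM('a))) * ennreal (c ^ DIM('a))) * (\<integral>\<^sup>+x. f (t + c *\<^sub>R x) \<partial>lborel)"
    by (simp add: mult.assoc)
  also have "ennreal (c powr (- real DIM('a))) * ennreal (c ^ DIM('a)) = 1"
    using c by (simp flip: ennreal_mult add: powr_minus powr_realpow)
  finally show ?thesis by simp
qed

lemma integrable_dilation:
  fixes f :: "'a::euclidean_space \<Rightarrow> real"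
  assumes f: "integrable lborel f" and c: "c > 0"
  shows "integrable lborel (\<lambda>x. f (c *\<^sub>R x))"
proof -
  have [measurable]: "f \<in> borel_measurable borel"
    using f by auto
  have "(\<integral>\<^sup>+x. ennreal (norm (f (c *\<^sub>R x))) \<partial>lborel)
      = ennreal (c powr (- real DIM('a))) * (\<integral>\<^sup>+x. ennreal (norm (f x)) \<partial>lborel)"
    using nn_integral_lborel_affine[of "\<lambda>x. ennreal (norm (f x))" c 0] c by simp
  with f show ?thesis
    unfolding integrable_iff_bounded by (auto simp: ennreal_mult_less_top)
qed

lemma integral_dilation:
  fixes f :: "'a::euclidean_space \<Rightarrow> real"
  assumes c: "c > 0"
  shows "(\<integral>x. f (c *\<^sub>R x) \<partial>lborel) = c powr (- real DIM('a)) * (\<integral>x. f x \<partial>lborel)"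
proof (cases "integrable lborel f")
  case f: True
  then have [measurable]: "f \<in> borel_measurable borel"
    by auto
  have "(\<integral>x. f x \<partial>lborel) = c ^ DIM('a) * (\<integral>x. f (c *\<^sub>R x) \<partial>lborel)"
    using c integrable_dilation[OF f c]
    by (subst lborel_affine[of c 0]) (auto simp: integral_density integral_distr)
  then show ?thesis
    using c by (simp add: powr_minus powr_realpow)
next
  case False
  moreover have "\<not> integrable lborel (\<lambda>x. f (c *\<^sub>R x))"
  proof
    assume "integrable lborel (\<lambda>x. f (c *\<^sub>R x))"
    from integrable_dilation[OF this, of "1/c"] c have "integrable lborel f" by simp
    with False show False ..
  qed
  ultimately show ?thesis
    by (simp add: not_integrable_integral_eq)
qed

text \<open>The divergence theorem for the field \<open>f(x) x\<close>, in a form that tolerates a singularity at the origin: along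
  rays, \<open>f (2 x) - f x\<close> is the integral of \<open>g (t x) / t\<close> over \<open>1 \<le> t \<le> 2\<close> where \<open>g x = D x \<bullet> x\<close>. Integrating in
  \<open>x\<close>, exchanging the integrals and undoing the dilations gives the same numerical factor \<open>1 - 2\<^bsup>-N\<^esup>\<close> on
  both sides.\<close>

lemma integral_euler_field:
  fixes f :: "'a::euclidean_space \<Rightarrow> real" and D :: "'a \<Rightarrow> 'a"
  assumes der: "\<And>x. x \<noteq> 0 \<Longrightarrow> (f has_derivative (\<lambda>h. D x \<bullet> h)) (at x)"
    and cont: "continuous_on (- {0}) D"
    and f: "integrable lborel f" and g: "integrable lborel (\<lambda>x. D x \<bullet> x)"
  shows "(\<integral>x. D x \<bullet> x \<partial>lborel) = - real DIM('a) * (\<integral>x. f x \<partial>lborel)"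
proof -
  let ?n = "real DIM('a)"
  define g where "g = (\<lambda>x. D x \<bullet> x)"
  have g_int: "integrable lborel g" using g by (simp add: g_def)
  have [measurable]: "g \<in> borel_measurable borel"
    using g_int by auto
  define k where "k t x = g (t *\<^sub>R x) / t * indicator {1..2} t" for t x
  have k_meas: "(\<lambda>(t, x). k t x) \<in> borel_measurable (lborel \<Otimes>\<^sub>M lborel)"
    unfolding k_def by measurable
  have ray: "has_bochner_integral lborel (\<lambda>t. k t x) (f (2 *\<^sub>R x) - f x)" if x: "x \<noteq> 0" for x
  proof -
    have 1: "DERIV (\<lambda>t. f (t *\<^sub>R x)) t :> g (t *\<^sub>R x) / t" if t: "1 \<le> t" for t
    proof -
      have "((\<lambda>t. f (t *\<^sub>R x)) has_derivative (\<lambda>h. D (t *\<^sub>R x) \<bullet> (h *\<^sub>R x))) (at t)"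
        by (rule has_derivative_compose[where f="\<lambda>t. t *\<^sub>R x" and g=f, OF _ der])
           (use t x in \<open>auto intro!: derivative_eq_intros\<close>)
      then show ?thesis
        unfolding has_field_derivative_def g_def
        by (rule has_derivative_eq_rhs) (use t in \<open>auto simp: fun_eq_iff\<close>)
    qed
    have 2: "isCont (\<lambda>t. g (t *\<^sub>R x) / t) t" if t: "1 \<le> t" for t
    proof -
      have "isCont D (t *\<^sub>R x)"
        using cont x t by (simp add: continuous_on_eq_continuous_at open_Compl)
      then have "isCont (\<lambda>t. D (t *\<^sub>R x)) t"
        by (intro isCont_o2[where g=D and f="\<lambda>t. t *\<^sub>R x"]) (auto intro!: continuous_intros)
      then show ?thesis
        using t unfolding g_def by (intro continuous_intros) auto
    qed
    show ?thesis
      unfolding k_def using has_bochner_integral_FTC_Icc_real[of 1 2 "\<lambda>t. f (t *\<^sub>R x)" "\<lambda>t. g (t *\<^sub>R x) / t"] 1 2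
      by simp
  qed
  have w: "has_bochner_integral lborel (\<lambda>t. t powr (- ?n - 1) * indicator {1..2} t) ((1 - 2 powr (- ?n)) / ?n)"
  proof -
    have "has_bochner_integral lborel (\<lambda>t. t powr (- ?n - 1) * indicator {1..2} t)
        (2 powr (- ?n) / (- ?n) - 1 powr (- ?n) / (- ?n))"
      by (rule has_bochner_integral_FTC_Icc_real) (auto intro!: derivative_eq_intros continuous_intros)
    then show ?thesis by (simp add: diff_divide_distrib)
  qed
  have slice: "k t = (\<lambda>x. (indicator {1..2} t / t) * g (t *\<^sub>R x))" for t
    by (auto simp: k_def)
  have slice_int: "integrable lborel (k t)" for t
  proof (cases "t \<in> {1..2}")
    case True
    then show ?thesis unfolding slice
      by (intro integrable_mult_right integrable_dilation[OF g_int]) auto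
  next
    case False
    then have "k t = (\<lambda>x. 0)" by (auto simp: k_def)
    then show ?thesis by simp
  qed
  \<comment> \<open>The homogeneous \<open>F\<close> is instantiated with the absolute value for integrability and with the identity for the value.\<close>
  have slice_val: "(\<integral>x. F (k t x) \<partial>lborel) = t powr (- ?n - 1) * indicator {1..2} t * (\<integral>x. F (g x) \<partial>lborel)"
    if F: "\<And>r s. r \<ge> 0 \<Longrightarrow> F (r * s) = r * F s" for t and F :: "real \<Rightarrow> real"
  proof (cases "t \<in> {1..2}")
    case True
    then have "(\<integral>x. F (k t x) \<partial>lborel) = (1 / t) * (\<integral>x. F (g (t *\<^sub>R x)) \<partial>lborel)"
      using F[of "1 / t"] unfolding k_def by simp
    also have "\<dots> = (1 / t) * (t powr (- ?n) * (\<integral>x. F (g x) \<partial>lborel))"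
      using integral_dilation[of t "\<lambda>x. F (g x)"] True by simp
    finally show ?thesis
      using True by (simp add: powr_diff)
  next
    case False
    then show ?thesis using F[of 0 0] by (simp add: k_def)
  qed
  have k_int: "integrable (lborel \<Otimes>\<^sub>M lborel) (\<lambda>(t, x). k t x)"
  proof (rule lborel_pair.Fubini_integrable)
    show "integrable lborel (\<lambda>t. \<integral>x. norm (case (t, x) of (t, x) \<Rightarrow> k t x) \<partial>lborel)"
      using slice_val[of norm] w
      by (simp add: abs_mult) (auto intro!: integrable_mult_left dest: integrable.intros)
  qed (use k_meas slice_int in auto)
  have "(\<integral>t. (\<integral>x. k t x \<partial>lborel) \<partial>lborel) = (\<integral>x. (\<integral>t. k t x \<partial>lborel) \<partial>lborel)"
    using lborel_pair.Fubini_integral[OF k_int] by simp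
  also have "\<dots> = (\<integral>x. f (2 *\<^sub>R x) - f x \<partial>lborel)"
  proof (rule integral_cong_AE)
    show "(\<lambda>x. \<integral>t. k t x \<partial>lborel) \<in> borel_measurable lborel"
      using lborel_pair.integrable_snd[OF k_int] by auto
    show "(\<lambda>x. f (2 *\<^sub>R x) - f x) \<in> borel_measurable lborel"
      using f integrable_dilation[OF f, of 2] by auto
    show "AE x in lborel. (\<integral>t. k t x \<partial>lborel) = f (2 *\<^sub>R x) - f x"
      using AE_lborel_singleton[of 0]
      by eventually_elim (use ray in \<open>auto simp: has_bochner_integral_iff\<close>)
  qed
  also have "\<dots> = (2 powr (- ?n) - 1) * (\<integral>x. f x \<partial>lborel)"
    using f integrable_dilation[OF f, of 2] integral_dilation[of 2 f] by (simp add: algebra_simps)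
  also have "(\<integral>t. (\<integral>x. k t x \<partial>lborel) \<partial>lborel) = (1 - 2 powr (- ?n)) / ?n * (\<integral>x. g x \<partial>lborel)"
    using slice_val[of "\<lambda>x. x"] w by (simp add: has_bochner_integral_iff)
  finally have eq: "(1 - 2 powr (- ?n)) / ?n * (\<integral>x. g x \<partial>lborel) = (2 powr (- ?n) - 1) * (\<integral>x. f x \<partial>lborel)" .
  define q where "q = 1 - 2 powr (- ?n)"
  have "2 powr (- ?n) < 2 powr 0"
    by (rule powr_less_mono) auto
  then have q: "q \<noteq> 0" by (simp add: q_def)
  have "q * (\<integral>x. g x \<partial>lborel) = q * (- ?n * (\<integral>x. f x \<partial>lborel))"
    using eq by (simp add: field_simps flip: q_def) (simp add: q_def algebra_simps)
  with q have "(\<integral>x. g x \<partial>lborel) = - ?n * (\<integral>x. f x \<partial>lborel)"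
    by (metis mult_left_cancel)
  then show ?thesis
    by (simp add: g_def)
qed

text \<open>Euler's identity for \<open>\<bar>f\<bar>\<^bsup>p\<^esup> h(\<bar>x\<bar>)\<close>. With \<open>h = \<rho>\<^bsup>-M\<^esup>\<close> it produces the mixed term of the deficit, and
  with the weight of \<open>radial_derivative_lyapunov_weight\<close> it drives the Poincare inequality; in the latter case \<open>f\<close>
  is a test function minus a constant, so integrability is assumed instead of compact support.\<close>

lemma integral_radial_weight:
  fixes f :: "'a::euclidean_space \<Rightarrow> real" and G :: "'a \<Rightarrow> 'a" and h h' :: "real \<Rightarrow> real"
  assumes p: "p \<ge> 2"
    and f': "\<And>x. (f has_derivative (\<lambda>v. G x \<bullet> v)) (at x)" and G: "continuous_on UNIV G"
    and h': "\<And>r. r > 0 \<Longrightarrow> (h has_real_derivative h' r) (at r)" and h'c: "continuous_on {0<..} h'"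
    and i1: "integrable lborel (\<lambda>x. \<bar>f x\<bar> powr p * h (norm x))"
    and i2: "integrable lborel (\<lambda>x. \<bar>f x\<bar> powr p * (norm x * h' (norm x)))"
    and i3: "integrable lborel (\<lambda>x. \<bar>f x\<bar> powr (p - 2) * f x * (G x \<bullet> x) * h (norm x))"
  shows "(\<integral>x. \<bar>f x\<bar> powr p * (real DIM('a) * h (norm x) + norm x * h' (norm x)) \<partial>lborel)
    = - p * (\<integral>x. \<bar>f x\<bar> powr (p - 2) * f x * (G x \<bullet> x) * h (norm x) \<partial>lborel)"
proof -
  define D where "D = (\<lambda>x. (p * (\<bar>f x\<bar> powr (p - 2) * f x) * h (norm x)) *\<^sub>R G x
    + (\<bar>f x\<bar> powr p * h' (norm x)) *\<^sub>R sgn x)"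
  have fc: "continuous_on UNIV f"
    using f' by (auto simp: continuous_on_eq_continuous_at intro: has_derivative_continuous)
  have hc: "continuous_on {0<..} h"
    using h' by (auto simp: continuous_on_eq_continuous_at open_greaterThan intro!: DERIV_isCont)
  have Dx: "D x \<bullet> x = p * (\<bar>f x\<bar> powr (p - 2) * f x * (G x \<bullet> x) * h (norm x))
      + \<bar>f x\<bar> powr p * (norm x * h' (norm x))" for x
  proof -
    have "sgn x \<bullet> x = norm x"
      by (cases "x = 0") (simp_all add: sgn_div_norm flip: norm_eq_sqrt_inner, simp add: dot_square_norm power2_eq_square)
    then show ?thesis by (simp add: D_def inner_simps)
  qed
  have "(\<integral>x. D x \<bullet> x \<partial>lborel) = - real DIM('a) * (\<integral>x. \<bar>f x\<bar> powr p * h (norm x) \<partial>lborel)"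
  proof (rule integral_euler_field[OF _ _ i1])
    fix x :: 'a assume x: "x \<noteq> 0"
    have 1: "((\<lambda>x. \<bar>f x\<bar> powr p) has_derivative (\<lambda>v. (G x \<bullet> v) * (p * (\<bar>f x\<bar> powr (p - 2) * f x)))) (at x)"
      using has_derivative_compose[OF f' has_real_derivative_abs_powr[of p, THEN has_field_derivative_imp_has_derivative]] p
      by (simp add: mult.commute)
    have 2: "((\<lambda>x. h (norm x)) has_derivative (\<lambda>v. (v \<bullet> sgn x) * h' (norm x))) (at x)"
      using has_derivative_compose[OF has_derivative_norm[OF x] h'[THEN has_field_derivative_imp_has_derivative]] x
      by (simp add: mult.commute)
    show "((\<lambda>x. \<bar>f x\<bar> powr p * h (norm x)) has_derivative (\<lambda>v. D x \<bullet> v)) (at x)"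
      by (rule has_derivative_eq_rhs[OF has_derivative_mult[OF 1 2]])
         (auto simp: D_def fun_eq_iff inner_simps inner_commute algebra_simps)
  next
    have c1: "continuous_on S (\<lambda>x. \<bar>f x\<bar> powr (p - 2) * f x)" for S
      using continuous_on_compose2[OF continuous_abs_powr_times[OF p] fc] continuous_on_subset by auto
    have c2: "continuous_on (- {0}) (\<lambda>x::'a. h (norm x))" "continuous_on (- {0}) (\<lambda>x::'a. h' (norm x))"
      by (auto intro!: continuous_on_compose2[OF hc] continuous_on_compose2[OF h'c] continuous_intros)
    show "continuous_on (- {0}) D"
      unfolding D_def sgn_div_norm
      by (intro continuous_intros c1 c2 continuous_on_subset[OF G] continuous_on_subset[OF fc] continuous_on_powr') (use p in auto)
  next
    show "integrable lborel (\<lambda>x. D x \<bullet> x)"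
      unfolding Dx using i2 i3 by auto
  qed
  moreover have "(\<integral>x. D x \<bullet> x \<partial>lborel) = p * (\<integral>x. \<bar>f x\<bar> powr (p - 2) * f x * (G x \<bullet> x) * h (norm x) \<partial>lborel)
      + (\<integral>x. \<bar>f x\<bar> powr p * (norm x * h' (norm x)) \<partial>lborel)"
    unfolding Dx using i2 i3 by (subst Bochner_Integration.integral_add) auto
  moreover have "(\<integral>x. \<bar>f x\<bar> powr p * (real DIM('a) * h (norm x) + norm x * h' (norm x)) \<partial>lborel)
     = real DIM('a) * (\<integral>x. \<bar>f x\<bar> powr p * h (norm x) \<partial>lborel) + (\<integral>x. \<bar>f x\<bar> powr p * (norm x * h' (norm x)) \<partial>lborel)"
  proof -
    have "(\<lambda>x. \<bar>f x\<bar> powr p * (real DIM('a) * h (norm x) + norm x * h' (norm x)))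
      = (\<lambda>x. real DIM('a) * (\<bar>f x\<bar> powr p * h (norm x)) + \<bar>f x\<bar> powr p * (norm x * h' (norm x)))"
      by (auto simp: algebra_simps)
    then show ?thesis
      using i1 i2 by (simp add: Bochner_Integration.integral_add)
  qed
  ultimately show ?thesis by linarith
qed

section \<open>Integrability of radial weights\<close>

lemma integrable_vanish_outside_annulus:
  fixes F :: "'a::euclidean_space \<Rightarrow> real"
  assumes F: "continuous_on (- {0}) F" and r: "0 < r" and z: "\<And>x. norm x < r \<or> R < norm x \<Longrightarrow> F x = 0"
  shows "integrable lborel F"
proof -
  have "compact (cball 0 R - ball 0 r :: 'a set)"
    by (rule compact_diff) auto
  moreover have "continuous_on (cball 0 R - ball 0 r) F"
    by (rule continuous_on_subset[OF F]) (use r in auto)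
  ultimately have "integrable lborel (\<lambda>x. indicator (cball 0 R - ball 0 r) x *\<^sub>R F x)"
    by (rule borel_integrable_compact)
  also have "(\<lambda>x. indicator (cball 0 R - ball 0 r) x *\<^sub>R F x) = F"
  proof
    fix x show "indicator (cball 0 R - ball 0 r) x *\<^sub>R F x = F x"
      using z[of x] by (cases "norm x < r \<or> R < norm x") (auto simp: indicator_def)
  qed
  finally show ?thesis .
qed

text \<open>A dyadic layer cake. The parameter \<open>\<sigma>\<close> selects the unit ball (\<open>\<sigma> = -1\<close>) or its exterior
  (\<open>\<sigma> = 1\<close>): on the part where \<open>\<sigma> log\<^sub>2 \<bar>x\<bar>\<close> lies in \<open>[k, k + 1)\<close> the integrand is at most a constant times
  \<open>2\<^bsup>-M\<sigma>k\<^esup>\<close>, and this part lies in the ball of radius \<open>2 \<cdot> 2\<^bsup>\<sigma>k\<^esup>\<close>. The volumes sum to a geometric series of ratio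
  \<open>2\<^bsup>\<sigma>(N-M)\<^esup>\<close>.\<close>

lemma nn_integral_norm_powr_finite:
  fixes M \<sigma> :: real
  assumes \<sigma>: "\<sigma> = 1 \<or> \<sigma> = -1" and M: "\<sigma> * (real DIM('a::euclidean_space) - M) < 0"
  shows "(\<integral>\<^sup>+x. ennreal (norm (x::'a) powr (- M) * indicator {x. 0 \<le> \<sigma> * log 2 (norm x)} x) \<partial>lborel) < \<infinity>"
proof -
  let ?n = "real DIM('a)"
  define c where "c k = 2 powr \<bar>M\<bar> * 2 powr (- M * \<sigma> * real k)" for k
  define B where "B k = ball (0::'a) (2 * 2 powr (\<sigma> * real k))" for k
  have [measurable]: "B k \<in> sets borel" for k by (simp add: B_def)
  have "ennreal (norm x powr (- M) * indicator {x. 0 \<le> \<sigma> * log 2 (norm x)} x) \<le> (\<Sum>k. ennreal (c k) * indicator (B k) x)"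
    if x: "x \<noteq> 0" for x :: 'a
  proof (cases "0 \<le> \<sigma> * log 2 (norm x)")
    case True
    define l where "l = \<sigma> * log 2 (norm x)"
    define k where "k = nat \<lfloor>l\<rfloor>"
    have k: "real k \<le> l" "l < real k + 1"
      using True unfolding k_def l_def by linarith+
    have nx: "norm x = 2 powr (\<sigma> * l)"
      using x \<sigma> by (auto simp: l_def)
    have "\<sigma> * l < 1 + \<sigma> * real k"
      using k \<sigma> by auto
    then have "norm x < 2 powr (1 + \<sigma> * real k)"
      unfolding nx by (intro powr_less_mono) auto
    then have xB: "x \<in> B k"
      by (simp add: B_def powr_add)
    have "norm x powr (- M) = 2 powr (\<sigma> * l * (- M))"
      by (simp add: nx powr_powr)
    also have "\<dots> \<le> 2 powr (\<bar>M\<bar> + (- M * \<sigma> * real k))"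
    proof (rule powr_mono)
      have "(- \<sigma> * M) * (l - real k) \<le> \<bar>- \<sigma> * M\<bar> * \<bar>l - real k\<bar>"
        by (metis abs_ge_self abs_mult)
      also have "\<dots> \<le> \<bar>M\<bar> * 1"
        using k \<sigma> by (intro mult_mono) auto
      finally show "\<sigma> * l * (- M) \<le> \<bar>M\<bar> + (- M * \<sigma> * real k)"
        by (simp add: algebra_simps)
    qed simp
    also have "\<dots> = c k" unfolding c_def by (rule powr_add)
    finally have "ennreal (norm x powr (- M) * indicator {x. 0 \<le> \<sigma> * log 2 (norm x)} x) \<le> ennreal (c k) * indicator (B k) x"
      using xB True by (simp add: ennreal_leI)
    also have "\<dots> \<le> (\<Sum>k. ennreal (c k) * indicator (B k) x)"
    proof -
      define t where "t = (\<lambda>j. ennreal (c j) * indicator (B j) x)"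
      have "t k \<le> suminf t" using sum_le_suminf[of t "{k}"] by simp
      then show ?thesis by (simp add: t_def)
    qed
    finally show ?thesis .
  qed simp
  then have "(\<integral>\<^sup>+x. ennreal (norm (x::'a) powr (- M) * indicator {x. 0 \<le> \<sigma> * log 2 (norm x)} x) \<partial>lborel)
    \<le> (\<integral>\<^sup>+x. (\<Sum>k. ennreal (c k) * indicator (B k) x) \<partial>lborel)"
    by (intro nn_integral_mono_AE) (use AE_lborel_singleton[of 0] in eventually_elim, auto)
  also have "\<dots> = (\<Sum>k. ennreal (c k) * emeasure lborel (B k))"
    by (subst nn_integral_suminf) (auto simp: nn_integral_cmult)
  also have "\<dots> = (\<Sum>k. ennreal (2 powr \<bar>M\<bar> * unit_ball_vol ?n * 2 powr ?n * (2 powr (\<sigma> * (?n - M))) ^ k))"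
  proof (intro suminf_cong)
    fix k
    have 1: "(2 * 2 powr (\<sigma> * real k)) ^ DIM('a) = 2 powr ?n * 2 powr (\<sigma> * real k * ?n)"
      by (simp add: power_mult_distrib powr_powr flip: powr_realpow)
    have 2: "(2 powr (\<sigma> * (?n - M))) ^ k = 2 powr (\<sigma> * real k * ?n) * 2 powr (- M * \<sigma> * real k)"
      by (simp add: powr_powr flip: powr_realpow powr_add) (simp add: algebra_simps)
    have "c k * (unit_ball_vol ?n * (2 * 2 powr (\<sigma> * real k)) ^ DIM('a))
      = 2 powr \<bar>M\<bar> * unit_ball_vol ?n * 2 powr ?n * (2 powr (\<sigma> * (?n - M))) ^ k"
      unfolding 1 2 c_def by simp
    then show "ennreal (c k) * emeasure lborel (B k)
      = ennreal (2 powr \<bar>M\<bar> * unit_ball_vol ?n * 2 powr ?n * (2 powr (\<sigma> * (?n - M))) ^ k)"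
      by (simp add: B_def emeasure_ball c_def flip: ennreal_mult)
  qed
  also have "\<dots> < \<infinity>"
  proof -
    have "2 powr (\<sigma> * (?n - M)) < 2 powr 0" using M by (intro powr_less_mono) auto
    then have "summable (\<lambda>k. 2 powr \<bar>M\<bar> * unit_ball_vol ?n * 2 powr ?n * (2 powr (\<sigma> * (?n - M))) ^ k)"
      by (intro summable_mult summable_geometric) auto
    then show ?thesis
      by (subst suminf_ennreal2) auto
  qed
  finally show ?thesis .
qed

lemma integrable_radial_bounds:
  fixes F :: "'a::euclidean_space \<Rightarrow> real"
  assumes [measurable]: "F \<in> borel_measurable borel" and M: "M < real DIM('a)" and K: "real DIM('a) < K"
    and near: "\<And>x. 0 < norm x \<Longrightarrow> norm x \<le> 1 \<Longrightarrow> \<bar>F x\<bar> \<le> C * norm x powr (- M)"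
    and far: "\<And>x. 1 \<le> norm x \<Longrightarrow> \<bar>F x\<bar> \<le> C * norm x powr (- K)"
  shows "integrable lborel F"
proof -
  define S where "S \<sigma> = {x::'a. 0 \<le> \<sigma> * log 2 (norm x)}" for \<sigma> :: real
  have [measurable]: "S \<sigma> \<in> sets borel" for \<sigma> unfolding S_def by measurable
  have bd: "\<bar>F x\<bar> \<le> \<bar>C\<bar> * (norm x powr (- M) * indicator (S (-1)) x + norm x powr (- K) * indicator (S 1) x)"
    if x: "x \<noteq> 0" for x
  proof (cases "norm x \<le> 1")
    case True
    have "\<bar>F x\<bar> \<le> C * norm x powr (- M)" using near[of x] True x by simp
    also have "\<dots> \<le> \<bar>C\<bar> * norm x powr (- M)" by (intro mult_right_mono) auto
    also have "\<dots> \<le> \<bar>C\<bar> * (norm x powr (- M) * indicator (S (-1)) x + norm x powr (- K) * indicator (S 1) x)"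
      using True x by (intro mult_left_mono) (auto simp: S_def indicator_def)
    finally show ?thesis .
  next
    case False
    have "\<bar>F x\<bar> \<le> C * norm x powr (- K)" using far[of x] False by simp
    also have "\<dots> \<le> \<bar>C\<bar> * norm x powr (- K)" by (intro mult_right_mono) auto
    also have "\<dots> \<le> \<bar>C\<bar> * (norm x powr (- M) * indicator (S (-1)) x + norm x powr (- K) * indicator (S 1) x)"
      using False x by (intro mult_left_mono) (auto simp: S_def indicator_def)
    finally show ?thesis .
  qed
  have "integrable lborel (\<lambda>x. norm x powr (- M) * indicator (S (-1)) x)"
    using nn_integral_norm_powr_finite[of "-1" M, where 'a='a] M
    by (intro integrableI_nonneg) (auto simp: S_def)
  moreover have "integrable lborel (\<lambda>x. norm x powr (- K) * indicator (S 1) x)"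
    using nn_integral_norm_powr_finite[of 1 K, where 'a='a] K
    by (intro integrableI_nonneg) (auto simp: S_def)
  ultimately have "integrable lborel (\<lambda>x. \<bar>C\<bar> * (norm x powr (- M) * indicator (S (-1)) x + norm x powr (- K) * indicator (S 1) x))"
    by auto
  then show ?thesis
  proof (rule Bochner_Integration.integrable_bound)
    show "AE x in lborel. norm (F x) \<le> norm (\<bar>C\<bar> * (norm x powr (- M) * indicator (S (-1)) x + norm x powr (- K) * indicator (S 1) x))"
      using AE_lborel_singleton[of 0]
    proof eventually_elim
      case (elim x)
      from bd[OF elim] show ?case unfolding real_norm_def by (rule order_trans) (rule abs_ge_self)
    qed
  qed simp
qed

text \<open>After taking logarithms this is \<open>ln t \<le> t\<close> for \<open>t = k y / \<alpha>\<close>.\<close>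

lemma powr_times_exp_le:
  fixes \<alpha> k y :: real
  assumes "\<alpha> > 0" "k > 0" "y > 0"
  shows "y powr \<alpha> * exp (- k * y) \<le> (\<alpha> / k) powr \<alpha>"
proof -
  have "ln (k * y / \<alpha>) \<le> k * y / \<alpha> - 1"
    using assms by (intro ln_le_minus_one) auto
  moreover have "ln (k * y / \<alpha>) = ln y - ln (\<alpha> / k)"
    using assms by (simp add: ln_div ln_mult)
  ultimately have "\<alpha> * ln y \<le> \<alpha> * (k * y / \<alpha> + ln (\<alpha> / k))"
    using assms by (intro mult_left_mono) auto
  also have "\<dots> = k * y + \<alpha> * ln (\<alpha> / k)"
    using assms by (simp add: distrib_left)
  finally have "exp (\<alpha> * ln y - k * y) \<le> exp (\<alpha> * ln (\<alpha> / k))"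
    by simp
  then show ?thesis
    using assms by (simp add: powr_def exp_diff exp_minus divide_inverse)
qed

lemma integrable_stretched_exponential_weight:
  fixes M \<delta> k :: real
  assumes M: "M < real DIM('a::euclidean_space)" and \<delta>: "\<delta> > 0" and k: "k > 0"
  shows "integrable lborel (\<lambda>x::'a. (1 + norm x powr \<delta>) * (norm x powr (- M) * exp (- k * norm x powr \<delta>)))"
proof -
  let ?n = "real DIM('a)"
  define \<alpha> where "\<alpha> = (\<delta> + ?n + 1 - M) / \<delta>"
  have \<alpha>: "\<alpha> > 0" using M \<delta> by (simp add: \<alpha>_def)
  show ?thesis
  proof (rule integrable_radial_bounds[OF _ M, of _ "?n + 1" "2 + 2 * (\<alpha> / k) powr \<alpha>"])
    fix x :: 'a assume x: "0 < norm x" "norm x \<le> 1"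
    have 1: "1 + norm x powr \<delta> \<le> 2 + 2 * (\<alpha> / k) powr \<alpha>"
      using powr_mono2[of \<delta> "norm x" 1] x \<delta> by (smt (verit) powr_one_eq_one powr_ge_zero)
    have 2: "norm x powr (- M) * exp (- k * norm x powr \<delta>) \<le> norm x powr (- M) * 1"
      using k by (intro mult_left_mono) auto
    have "(1 + norm x powr \<delta>) * (norm x powr (- M) * exp (- k * norm x powr \<delta>)) \<le> (2 + 2 * (\<alpha> / k) powr \<alpha>) * (norm x powr (- M) * 1)"
      by (intro mult_mono 1 2) auto
    then show "\<bar>(1 + norm x powr \<delta>) * (norm x powr (- M) * exp (- k * norm x powr \<delta>))\<bar> \<le> (2 + 2 * (\<alpha> / k) powr \<alpha>) * norm x powr (- M)"
      by (simp add: abs_mult)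
  next
    fix x :: 'a assume x: "1 \<le> norm x"
    have "norm x powr (\<delta> + ?n + 1 - M) * exp (- k * norm x powr \<delta>) = (norm x powr \<delta>) powr \<alpha> * exp (- k * norm x powr \<delta>)"
      using \<delta> by (simp add: \<alpha>_def powr_powr)
    also have "\<dots> \<le> (\<alpha> / k) powr \<alpha>"
      using x by (intro powr_times_exp_le \<alpha> k) auto
    finally have 1: "norm x powr (\<delta> + ?n + 1 - M) * exp (- k * norm x powr \<delta>) \<le> (\<alpha> / k) powr \<alpha>" .
    have "1 + norm x powr \<delta> \<le> 2 * norm x powr \<delta>"
      using ge_one_powr_ge_zero[of "norm x" \<delta>] x \<delta> by simp
    then have "(1 + norm x powr \<delta>) * (norm x powr (- M) * exp (- k * norm x powr \<delta>)) \<le> 2 * norm x powr \<delta> * (norm x powr (- M) * exp (- k * norm x powr \<delta>))"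
      by (intro mult_right_mono) auto
    also have "\<dots> = 2 * (norm x powr (\<delta> + ?n + 1 - M) * exp (- k * norm x powr \<delta>)) * norm x powr (- (?n + 1))"
      using x by (simp flip: powr_add)
    also have "\<dots> \<le> 2 * (\<alpha> / k) powr \<alpha> * norm x powr (- (?n + 1))"
      using 1 by (intro mult_right_mono mult_left_mono) auto
    also have "\<dots> \<le> (2 + 2 * (\<alpha> / k) powr \<alpha>) * norm x powr (- (?n + 1))"
      by (intro mult_right_mono) auto
    finally show "\<bar>(1 + norm x powr \<delta>) * (norm x powr (- M) * exp (- k * norm x powr \<delta>))\<bar> \<le> (2 + 2 * (\<alpha> / k) powr \<alpha>) * norm x powr (- (?n + 1))"
      by (simp add: abs_mult)
  qed auto
qed

section \<open>The Poincare inequality on a ball\<close>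

text \<open>The fundamental theorem of calculus along the segment, followed by Jensen's inequality on \<open>[0, 1]\<close>.\<close>

lemma powr_abs_increment_le_segment:
  fixes f :: "'a::euclidean_space \<Rightarrow> real"
  assumes p: "p \<ge> 1"
    and f': "\<And>x. (f has_derivative (\<lambda>v. G x \<bullet> v)) (at x)" and G: "continuous_on UNIV G"
  shows "ennreal (\<bar>f (y + w) - f y\<bar> powr p)
    \<le> ennreal (norm w powr p) * (\<integral>\<^sup>+t. ennreal (norm (G (y + t *\<^sub>R w)) powr p) * indicator {0..1} t \<partial>lborel)"
proof -
  define g where "g t = norm (G (y + t *\<^sub>R w))" for t
  have g0: "0 \<le> g t" for t by (simp add: g_def)
  have Gc: "isCont (\<lambda>t. G (y + t *\<^sub>R w)) t" for t
    using G by (intro isCont_o2[where g=G and f="\<lambda>t. y + t *\<^sub>R w"])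
      (auto intro!: continuous_intros simp: continuous_on_eq_continuous_at)
  have gc: "isCont g t" for t
    unfolding g_def by (intro continuous_intros Gc)
  have gpc: "isCont (\<lambda>t. g t powr p) t" for t
    using gc[of t] p g0 unfolding isCont_def by (intro tendsto_powr') auto
  have gi: "integrable lborel (\<lambda>t. g t * indicator {0..1} t)"
    and gpi: "integrable lborel (\<lambda>t. g t powr p * indicator {0..1} t)"
    using gc gpc by (auto intro!: borel_integrable_atLeastAtMost)
  define s where "s = (\<integral>t. g t * indicator {0..1} t \<partial>lborel)"
  have s0: "s \<ge> 0" unfolding s_def by (intro integral_nonneg_AE) (auto simp: g_def)
  have "has_bochner_integral lborel (\<lambda>t. (G (y + t *\<^sub>R w) \<bullet> w) * indicator {0..1} t) (f (y + 1 *\<^sub>R w) - f (y + 0 *\<^sub>R w))"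
  proof (rule has_bochner_integral_FTC_Icc_real)
    fix t :: real
    have "((\<lambda>t. f (y + t *\<^sub>R w)) has_derivative (\<lambda>h. G (y + t *\<^sub>R w) \<bullet> (h *\<^sub>R w))) (at t)"
      by (rule has_derivative_compose[where f="\<lambda>t. y + t *\<^sub>R w" and g=f, OF _ f']) (auto intro!: derivative_eq_intros)
    then show "((\<lambda>t. f (y + t *\<^sub>R w)) has_real_derivative G (y + t *\<^sub>R w) \<bullet> w) (at t)"
      unfolding has_field_derivative_def by (rule has_derivative_eq_rhs) (auto simp: fun_eq_iff)
  qed (auto intro!: continuous_intros Gc)
  then have 1: "integrable lborel (\<lambda>t. (G (y + t *\<^sub>R w) \<bullet> w) * indicator {0..1} t)"
    and 2: "f (y + w) - f y = (\<integral>t. (G (y + t *\<^sub>R w) \<bullet> w) * indicator {0..1} t \<partial>lborel)"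
    by (auto simp: has_bochner_integral_iff)
  have "\<bar>f (y + w) - f y\<bar> \<le> (\<integral>t. \<bar>(G (y + t *\<^sub>R w) \<bullet> w) * indicator {0..1} t\<bar> \<partial>lborel)"
    unfolding 2 using integral_norm_bound[of lborel "\<lambda>t. (G (y + t *\<^sub>R w) \<bullet> w) * indicator {0..1} t"] by simp
  also have "\<dots> \<le> (\<integral>t. norm w * (g t * indicator {0..1} t) \<partial>lborel)"
  proof (rule integral_mono)
    fix t
    show "\<bar>(G (y + t *\<^sub>R w) \<bullet> w) * indicator {0..1} t\<bar> \<le> norm w * (g t * indicator {0..1} t)"
      using Cauchy_Schwarz_ineq2[of "G (y + t *\<^sub>R w)" w] by (auto simp: g_def abs_mult mult.commute split: split_indicator)
  qed (use 1 gi in auto)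
  also have "\<dots> = norm w * s" by (simp add: s_def)
  finally have "\<bar>f (y + w) - f y\<bar> powr p \<le> (norm w * s) powr p"
    using p by (intro powr_mono2) auto
  also have "\<dots> = norm w powr p * s powr p" using s0 by (simp add: powr_mult)
  also have "s powr p \<le> (\<integral>t. g t powr p * indicator {0..1} t \<partial>lborel)"
  proof -
    have "has_bochner_integral lborel (\<lambda>t::real. indicator {0..1} t) (measure lborel {0..1::real})"
      by (rule has_bochner_integral_real_indicator) auto
    then have c1: "integrable lborel (\<lambda>t::real. indicator {0..1} t :: real)" "(\<integral>t. indicator {0..1::real} t \<partial>lborel) = (1::real)"
      by (auto simp: has_bochner_integral_iff)
    have "s powr p = (\<integral>t. s powr p * indicator {0..1} t + p * s powr (p - 1) * (g t * indicator {0..1} t - s * indicator {0..1} t) \<partial>lborel)"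
      using gi c1 by (simp add: s_def)
    also have "\<dots> \<le> (\<integral>t. g t powr p * indicator {0..1} t \<partial>lborel)"
    proof (rule integral_mono)
      fix t
      show "s powr p * indicator {0..1} t + p * s powr (p - 1) * (g t * indicator {0..1} t - s * indicator {0..1} t)
         \<le> g t powr p * indicator {0..1} t"
        using powr_tangent_le[of p s "g t"] p s0 by (auto simp: g_def split: split_indicator)
    qed (use gi gpi c1 in auto)
    finally show ?thesis .
  qed
  finally have "\<bar>f (y + w) - f y\<bar> powr p \<le> norm w powr p * (\<integral>t. g t powr p * indicator {0..1} t \<partial>lborel)"
    by (simp add: mult_left_mono)
  then have "ennreal (\<bar>f (y + w) - f y\<bar> powr p) \<le> ennreal (norm w powr p) * ennreal (\<integral>t. g t powr p * indicator {0..1} t \<partial>lborel)"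
    by (simp add: ennreal_leI flip: ennreal_mult')
  also have "ennreal (\<integral>t. g t powr p * indicator {0..1} t \<partial>lborel) = (\<integral>\<^sup>+t. ennreal (g t powr p * indicator {0..1} t) \<partial>lborel)"
    by (rule nn_integral_eq_integral[symmetric, OF gpi]) auto
  finally show ?thesis
    by (simp add: g_def ennreal_mult'' ennreal_indicator)
qed

text \<open>Only the half of each segment next to \<open>y\<close> is used: at time \<open>t\<close> its point is \<open>(1 - t/2) y + (t/2) z\<close>, so
  for fixed \<open>z\<close> and \<open>t\<close> the substitution in \<open>y\<close> maps the ball into itself with Jacobian at least \<open>2\<^bsup>-N\<^esup>\<close>. The whole
  segment would let the Jacobian degenerate at \<open>z\<close>.\<close>

lemma nn_integral_midpoint_increment:
  fixes f :: "'a::euclidean_space \<Rightarrow> real"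
  assumes p: "p \<ge> 1" and R: "R > 0"
    and f': "\<And>x. (f has_derivative (\<lambda>v. G x \<bullet> v)) (at x)" and G: "continuous_on UNIV G"
  shows "(\<integral>\<^sup>+z. (\<integral>\<^sup>+y. ennreal (\<bar>f ((1/2) *\<^sub>R (y + z)) - f y\<bar> powr p) * indicator (ball 0 R) y \<partial>lborel) * indicator (ball 0 R) z \<partial>lborel)
    \<le> ennreal (R powr p * 2 ^ DIM('a)) * emeasure lborel (ball (0::'a) R) * (\<integral>\<^sup>+y. ennreal (norm (G y) powr p) * indicator (ball 0 R) y \<partial>lborel)"
    (is "_ \<le> _ * _ * ?H")
proof -
  let ?B = "ball (0::'a) R"
  have [measurable]: "?B \<in> sets borel" by simp
  have [measurable]: "G \<in> borel_measurable borel" "f \<in> borel_measurable borel"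
    using G f' by (auto intro!: borel_measurable_continuous_onI continuous_at_imp_continuous_on intro: has_derivative_continuous)
  have inner: "(\<integral>\<^sup>+y. ennreal (\<bar>f ((1/2) *\<^sub>R (y + z)) - f y\<bar> powr p) * indicator ?B y \<partial>lborel) \<le> ennreal (R powr p * 2 ^ DIM('a)) * ?H"
    if z: "z \<in> ?B" for z
  proof -
    let ?K = "\<lambda>y t. ennreal (norm (G (y + t *\<^sub>R ((1/2) *\<^sub>R (z - y)))) powr p) * indicator {0..1} t * indicator ?B y"
    have "(\<integral>\<^sup>+y. ennreal (\<bar>f ((1/2) *\<^sub>R (y + z)) - f y\<bar> powr p) * indicator ?B y \<partial>lborel)
      \<le> (\<integral>\<^sup>+y. ennreal (R powr p) * (\<integral>\<^sup>+t. ?K y t \<partial>lborel) \<partial>lborel)"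
    proof (rule nn_integral_mono)
      fix y
      show "ennreal (\<bar>f ((1/2) *\<^sub>R (y + z)) - f y\<bar> powr p) * indicator ?B y \<le> ennreal (R powr p) * (\<integral>\<^sup>+t. ?K y t \<partial>lborel)"
      proof (cases "y \<in> ?B")
        case True
        let ?w = "(1/2) *\<^sub>R (z - y)"
        have m: "y + ?w = (1/2) *\<^sub>R (y + z)"
          by (rule euclidean_eqI) (simp add: inner_simps field_simps)
        have "norm (z - y) \<le> norm z + norm y" by (rule norm_triangle_ineq4)
        then have "norm ?w \<le> R" using True z by simp
        then have w: "norm ?w powr p \<le> R powr p" using p by (intro powr_mono2) auto
        have "ennreal (\<bar>f ((1/2) *\<^sub>R (y + z)) - f y\<bar> powr p)
          \<le> ennreal (norm ?w powr p) * (\<integral>\<^sup>+t. ennreal (norm (G (y + t *\<^sub>R ?w)) powr p) * indicator {0..1} t \<partial>lborel)"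
          using powr_abs_increment_le_segment[OF p f' G, of y ?w] unfolding m .
        also have "\<dots> \<le> ennreal (R powr p) * (\<integral>\<^sup>+t. ennreal (norm (G (y + t *\<^sub>R ?w)) powr p) * indicator {0..1} t \<partial>lborel)"
          by (intro mult_right_mono ennreal_leI w) auto
        finally show ?thesis using True by simp
      qed simp
    qed
    also have "\<dots> = ennreal (R powr p) * (\<integral>\<^sup>+y. \<integral>\<^sup>+t. ?K y t \<partial>lborel \<partial>lborel)"
      by (rule nn_integral_cmult) measurable
    also have "(\<integral>\<^sup>+y. \<integral>\<^sup>+t. ?K y t \<partial>lborel \<partial>lborel) = (\<integral>\<^sup>+t. \<integral>\<^sup>+y. ?K y t \<partial>lborel \<partial>lborel)"
      by (rule lborel_pair.Fubini') measurable
    also have "\<dots> \<le> (\<integral>\<^sup>+t. ennreal (2 ^ DIM('a)) * ?H * indicator {0..1::real} t \<partial>lborel)"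
    proof (rule nn_integral_mono)
      fix t :: real
      show "(\<integral>\<^sup>+y. ?K y t \<partial>lborel) \<le> ennreal (2 ^ DIM('a)) * ?H * indicator {0..1} t"
      proof (cases "t \<in> {0..1}")
        case True
        let ?c = "1 - t / 2"
        have c: "1/2 \<le> ?c" "?c \<le> 1" using True by auto
        have seg: "y + t *\<^sub>R ((1/2) *\<^sub>R (z - y)) = (t / 2) *\<^sub>R z + ?c *\<^sub>R y" for y
          by (simp add: algebra_simps)
        have inB: "(t / 2) *\<^sub>R z + ?c *\<^sub>R y \<in> ?B" if "y \<in> ?B" for y
          using z that c True by (intro convexD[OF convex_ball]) auto
        have "(\<integral>\<^sup>+y. ?K y t \<partial>lborel) \<le> (\<integral>\<^sup>+y. ennreal (norm (G ((t / 2) *\<^sub>R z + ?c *\<^sub>R y)) powr p) * indicator ?B ((t / 2) *\<^sub>R z + ?c *\<^sub>R y) \<partial>lborel)"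
          unfolding seg using inB True by (intro nn_integral_mono) (auto split: split_indicator)
        also have "\<dots> = ennreal (?c powr (- real DIM('a))) * ?H"
          using c by (intro nn_integral_lborel_affine[where f="\<lambda>y. ennreal (norm (G y) powr p) * indicator ?B y"]) auto
        also have "\<dots> \<le> ennreal (2 ^ DIM('a)) * ?H"
        proof (intro mult_right_mono ennreal_leI)
          have "?c powr (- real DIM('a)) \<le> (1/2) powr (- real DIM('a))"
            using c by (intro powr_mono2') auto
          also have "\<dots> = 2 ^ DIM('a)"
            by (simp add: powr_minus powr_realpow power_one_over)
          finally show "?c powr (- real DIM('a)) \<le> 2 ^ DIM('a)" .
        qed simp
        finally show ?thesis using True by simp
      qed simp
    qed
    also have "\<dots> = ennreal (2 ^ DIM('a)) * ?H"
      by (subst nn_integral_cmult) auto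
    finally show ?thesis
      by (simp add: mult.assoc ennreal_mult mult_left_mono)
  qed
  have "(\<integral>\<^sup>+z. (\<integral>\<^sup>+y. ennreal (\<bar>f ((1/2) *\<^sub>R (y + z)) - f y\<bar> powr p) * indicator ?B y \<partial>lborel) * indicator ?B z \<partial>lborel)
    \<le> (\<integral>\<^sup>+z. (ennreal (R powr p * 2 ^ DIM('a)) * ?H) * indicator ?B z \<partial>lborel)"
    using inner by (intro nn_integral_mono) (auto split: split_indicator)
  also have "\<dots> = ennreal (R powr p * 2 ^ DIM('a)) * ?H * emeasure lborel ?B"
    by (subst nn_integral_cmult) auto
  finally show ?thesis by (simp add: mult_ac)
qed

text \<open>Passing through the midpoint bounds the double integral of \<open>\<bar>f y - f z\<bar>\<^bsup>p\<^esup>\<close> over the ball. By averaging,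
  some \<open>z\<close> does at least as well as the mean, and \<open>c = f z\<close> for such a \<open>z\<close>.\<close>

lemma nn_integral_ball_poincare:
  fixes f :: "'a::euclidean_space \<Rightarrow> real"
  assumes p: "p \<ge> 1" and R: "R > 0"
    and f': "\<And>x. (f has_derivative (\<lambda>v. G x \<bullet> v)) (at x)" and G: "continuous_on UNIV G"
  shows "\<exists>c. (\<integral>\<^sup>+y. ennreal (\<bar>f y - c\<bar> powr p) * indicator (ball 0 R) y \<partial>lborel)
    \<le> ennreal (2 powr p * R powr p * 2 ^ DIM('a)) * (\<integral>\<^sup>+y. ennreal (norm (G y) powr p) * indicator (ball 0 R) y \<partial>lborel)"
    (is "\<exists>c. ?I c \<le> ?k * ?H")
proof (rule ccontr)
  let ?B = "ball (0::'a) R"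
  have [measurable]: "?B \<in> sets borel" by simp
  have [measurable]: "G \<in> borel_measurable borel" "f \<in> borel_measurable borel"
    using G f' by (auto intro!: borel_measurable_continuous_onI continuous_at_imp_continuous_on intro: has_derivative_continuous)
  assume "\<not> ?thesis"
  then have gt: "?k * ?H < ?I (f z)" for z by (auto simp: not_le)
  define J where "J = (\<lambda>y z. ennreal (\<bar>f ((1/2) *\<^sub>R (y + z)) - f y\<bar> powr p) * indicator ?B y * indicator ?B z)"
  have [measurable]: "case_prod J \<in> borel_measurable (lborel \<Otimes>\<^sub>M lborel)"
    unfolding J_def by measurable
  have mid: "(\<integral>\<^sup>+z. \<integral>\<^sup>+y. J y z \<partial>lborel \<partial>lborel) \<le> ennreal (R powr p * 2 ^ DIM('a)) * emeasure lborel ?B * ?H"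
    using nn_integral_midpoint_increment[OF p R f' G] unfolding J_def by (subst nn_integral_multc) auto
  have swap: "(\<integral>\<^sup>+z. \<integral>\<^sup>+y. J z y \<partial>lborel \<partial>lborel) = (\<integral>\<^sup>+z. \<integral>\<^sup>+y. J y z \<partial>lborel \<partial>lborel)"
    by (rule lborel_pair.Fubini'[symmetric]) measurable
  have tri: "ennreal (\<bar>f y - f z\<bar> powr p) * indicator ?B y * indicator ?B z \<le> ennreal (2 powr (p - 1)) * (J y z + J z y)" for y z
  proof -
    let ?m = "f ((1/2) *\<^sub>R (y + z))"
    have "\<bar>f y - f z\<bar> \<le> 2 * ((\<bar>?m - f y\<bar> + \<bar>?m - f z\<bar>) / 2)"
      using abs_triangle_ineq4[of "?m - f z" "?m - f y"] by simp
    then have "\<bar>f y - f z\<bar> powr p \<le> (2 * ((\<bar>?m - f y\<bar> + \<bar>?m - f z\<bar>) / 2)) powr p"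
      using p by (intro powr_mono2) auto
    also have "\<dots> = 2 powr p * ((\<bar>?m - f y\<bar> + \<bar>?m - f z\<bar>) / 2) powr p"
      by (rule powr_mult)
    also have "\<dots> \<le> 2 powr p * ((\<bar>?m - f y\<bar> powr p + \<bar>?m - f z\<bar> powr p) / 2)"
      using p by (intro mult_left_mono powr_mean_le) auto
    also have "\<dots> = 2 powr (p - 1) * (\<bar>?m - f y\<bar> powr p + \<bar>?m - f z\<bar> powr p)"
      by (simp add: powr_diff)
    finally have "ennreal (\<bar>f y - f z\<bar> powr p) \<le> ennreal (2 powr (p - 1)) * (ennreal (\<bar>?m - f y\<bar> powr p) + ennreal (\<bar>?m - f z\<bar> powr p))"
      by (simp add: ennreal_leI flip: ennreal_plus ennreal_mult')
    then show ?thesis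
      by (auto simp: J_def add.commute split: split_indicator)
  qed
  have "(\<integral>\<^sup>+z. ?I (f z) * indicator ?B z \<partial>lborel) = (\<integral>\<^sup>+z. \<integral>\<^sup>+y. ennreal (\<bar>f y - f z\<bar> powr p) * indicator ?B y * indicator ?B z \<partial>lborel \<partial>lborel)"
    by (subst nn_integral_multc) auto
  also have "\<dots> \<le> (\<integral>\<^sup>+z. \<integral>\<^sup>+y. ennreal (2 powr (p - 1)) * (J y z + J z y) \<partial>lborel \<partial>lborel)"
    by (intro nn_integral_mono tri)
  also have "\<dots> = ennreal (2 powr (p - 1)) * ((\<integral>\<^sup>+z. \<integral>\<^sup>+y. J y z \<partial>lborel \<partial>lborel) + (\<integral>\<^sup>+z. \<integral>\<^sup>+y. J z y \<partial>lborel \<partial>lborel))"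
    by (simp add: nn_integral_cmult nn_integral_add)
  also have "\<dots> \<le> ennreal (2 powr (p - 1)) * (2 * (ennreal (R powr p * 2 ^ DIM('a)) * emeasure lborel ?B * ?H))"
    unfolding swap mult_2 by (intro mult_left_mono add_mono mid) auto
  also have "\<dots> = ?k * ?H * emeasure lborel ?B"
  proof -
    have "?k = ennreal (2 powr (p - 1)) * 2 * ennreal (R powr p * 2 ^ DIM('a))"
      by (simp add: powr_diff flip: ennreal_mult' ennreal_numeral)
    then show ?thesis by (simp add: mult_ac)
  qed
  finally have le: "(\<integral>\<^sup>+z. ?I (f z) * indicator ?B z \<partial>lborel) \<le> ?k * ?H * emeasure lborel ?B" .
  \<comment> \<open>As a function of \<open>z\<close>, the integral of \<open>\<bar>f - f z\<bar>\<^bsup>p\<^esup>\<close> exceeds \<open>\<kappa>\<close> everywhere, yet its mean over the ball is at most \<open>\<kappa>\<close>.\<close>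
  define \<kappa> where "\<kappa> = ?k * ?H"
  have \<kappa>: "\<kappa> < \<infinity>"
    using less_le_trans[OF gt[of 0] top_greatest] by (simp add: \<kappa>_def)
  have [measurable]: "(\<lambda>z. ?I (f z)) \<in> borel_measurable lborel"
    by measurable
  have fin: "(\<integral>\<^sup>+z. \<kappa> * indicator ?B z \<partial>lborel) = \<kappa> * emeasure lborel ?B"
    by (subst nn_integral_cmult) auto
  have Bfin: "emeasure lborel ?B < \<infinity>"
    using emeasure_bounded_finite[of ?B] by simp
  have "(\<integral>\<^sup>+z. ?I (f z) * indicator ?B z - \<kappa> * indicator ?B z \<partial>lborel)
    = (\<integral>\<^sup>+z. ?I (f z) * indicator ?B z \<partial>lborel) - (\<integral>\<^sup>+z. \<kappa> * indicator ?B z \<partial>lborel)"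
  proof (rule nn_integral_diff)
    show "(\<integral>\<^sup>+z. \<kappa> * indicator ?B z \<partial>lborel) \<noteq> \<infinity>"
      unfolding fin using ennreal_mult_less_top[of \<kappa> "emeasure lborel ?B"] \<kappa> Bfin by auto
    show "AE z in lborel. \<kappa> * indicator ?B z \<le> ?I (f z) * indicator ?B z"
      using gt by (auto simp: \<kappa>_def less_imp_le split: split_indicator)
  qed measurable
  also have "\<dots> = 0"
  proof -
    have "\<kappa> * emeasure lborel ?B < top"
      using ennreal_mult_less_top[of \<kappa> "emeasure lborel ?B"] \<kappa> Bfin by auto
    with le[folded \<kappa>_def] show ?thesis
      unfolding fin diff_eq_0_iff_ennreal by (auto intro: le_less_trans)
  qed
  finally have "AE z in lborel. ?I (f z) * indicator ?B z - \<kappa> * indicator ?B z = 0"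
    by (subst (asm) nn_integral_0_iff_AE) auto
  then have "AE z in lborel. z \<notin> ?B"
  proof eventually_elim
    case (elim z)
    show ?case
    proof
      assume "z \<in> ?B"
      then have "?I (f z) - \<kappa> = 0" using elim by simp
      with gt[of z] show False
        unfolding \<kappa>_def[symmetric] by (metis diff_gt_0_iff_gt_ennreal less_irrefl)
    qed
  qed
  then have "emeasure lborel ?B = 0"
    by (subst (asm) AE_iff_measurable[where N="?B"]) auto
  then show False
    using R unit_ball_vol_pos[of "real DIM('a)"] by (simp add: emeasure_ball)
qed

section \<open>The weighted Poincare inequality\<close>

text \<open>In \<open>weighted_poincare\<close>, \<open>s\<close> stands for \<open>\<kappa> \<bar>x\<bar>\<^bsup>\<delta>\<^esup>\<close>. The first two terms of \<open>Q\<close> are the weighted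
  divergence of the chosen field, the last one is what Young's inequality takes away. The three bounds are meant for
  small, large and intermediate \<open>s\<close>.\<close>

lemma lyapunov_bound:
  fixes L \<delta> s :: real
  assumes L: "L > 0" and \<delta>: "\<delta> > 0" and s: "s \<ge> 0"
  defines "Q \<equiv> L * (1 - s)\<^sup>2 / (1 + s) - 2 * \<delta> * s / (1 + s)\<^sup>2 - L / 4 * (1 + s)"
  shows "3 / 4 * L - (13 / 4 * L + 2 * \<delta>) * s \<le> Q"
    and "3 / 4 * L * s - (13 / 4 * L + 2 * \<delta>) \<le> Q"
    and "- 2 * \<delta> - L / 4 * (1 + s) \<le> Q"
proof -
  have 1: "s / (1 + s)\<^sup>2 \<le> s" "s / (1 + s)\<^sup>2 \<le> 1"
  proof -
    have "s * 1 \<le> s * (1 + s)\<^sup>2" using s by (intro mult_left_mono) auto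
    then show "s / (1 + s)\<^sup>2 \<le> s" using s by (simp add: divide_le_eq)
    have "s \<le> (1 + s)\<^sup>2" using s by (simp add: power2_eq_square algebra_simps)
    then show "s / (1 + s)\<^sup>2 \<le> 1" using s by (simp add: divide_le_eq)
  qed
  have 2: "1 - 3 * s \<le> (1 - s)\<^sup>2 / (1 + s)" "s - 3 \<le> (1 - s)\<^sup>2 / (1 + s)" "0 \<le> (1 - s)\<^sup>2 / (1 + s)"
    using s sum_squares_ge_zero[of "1 - s" 0] by (simp_all add: le_divide_eq power2_eq_square algebra_simps)
  define \<alpha> where "\<alpha> = (1 - s)\<^sup>2 / (1 + s)"
  define \<beta> where "\<beta> = s / (1 + s)\<^sup>2"
  have Q: "Q = L * \<alpha> - 2 * \<delta> * \<beta> - L / 4 * (1 + s)"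
    by (simp add: Q_def \<alpha>_def \<beta>_def)
  note 1 = 1[folded \<beta>_def] and 2 = 2[folded \<alpha>_def]
  have m: "L * (1 - 3 * s) \<le> L * \<alpha>" "L * (s - 3) \<le> L * \<alpha>" "L * 0 \<le> L * \<alpha>"
    "2 * \<delta> * \<beta> \<le> 2 * \<delta> * s" "2 * \<delta> * \<beta> \<le> 2 * \<delta> * 1"
    using L \<delta> 1 2 by (intro mult_left_mono; simp)+
  show "3 / 4 * L - (13 / 4 * L + 2 * \<delta>) * s \<le> Q"
    using m(1,4) unfolding Q by (simp add: field_simps)
  show "3 / 4 * L * s - (13 / 4 * L + 2 * \<delta>) \<le> Q"
    using m(2,5) unfolding Q by (simp add: field_simps)
  show "- 2 * \<delta> - L / 4 * (1 + s) \<le> Q"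
    using m(3,5) unfolding Q by (simp add: field_simps)
qed

text \<open>Outside an annulus \<open>Q\<close> is at least \<open>L / 4\<close>, so that the positive part of the left side lives on the annulus,
  where the weight is bounded because it stays away from the origin.\<close>

lemma lyapunov_deficit_compact:
  fixes L \<delta> M \<kappa> k :: real
  assumes L: "L > 0" and \<delta>: "\<delta> > 0" and \<kappa>: "\<kappa> > 0" and k: "k > 0"
  obtains R K where "R > 0" "K \<ge> 0"
    "\<And>r. r > 0 \<Longrightarrow> (L / 4 - (L * (1 - \<kappa> * r powr \<delta>)\<^sup>2 / (1 + \<kappa> * r powr \<delta>) - 2 * \<delta> * (\<kappa> * r powr \<delta>) / (1 + \<kappa> * r powr \<delta>)\<^sup>2
        - L / 4 * (1 + \<kappa> * r powr \<delta>))) * (r powr (- M) * exp (- k * r powr \<delta>))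
      \<le> (if r < R then K else 0)"
proof -
  define A where "A = 13 / 4 * L + 2 * \<delta>"
  have A: "A > 0" using L \<delta> by (simp add: A_def)
  \<comment> \<open>Where the first, respectively the second, bound of \<open>lyapunov_bound\<close> reaches \<open>L / 4\<close>.\<close>
  define s0 where "s0 = L / (2 * A)"
  define s1 where "s1 = (A + L) / (3 / 4 * L)"
  have s: "0 < s0" "0 < s1" using A L by (auto simp: s0_def s1_def)
  define r0 where "r0 = (s0 / \<kappa>) powr (1 / \<delta>)"
  define R where "R = (s1 / \<kappa>) powr (1 / \<delta>)"
  have rpos: "0 < r0" "0 < R" using s \<kappa> by (auto simp: r0_def R_def)
  have rs: "\<kappa> * r0 powr \<delta> = s0" "\<kappa> * R powr \<delta> = s1"
    using \<delta> \<kappa> s by (auto simp: r0_def R_def powr_powr)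
  define B where "B = L / 4 + 2 * \<delta> + L / 4 * (1 + s1)"
  have B: "B > 0" unfolding B_def using L \<delta> s by (intro add_pos_pos mult_pos_pos) auto
  define K where "K = B * (r0 powr (- M) + R powr (- M))"
  have K: "K \<ge> 0" using B by (simp add: K_def)
  show ?thesis
  proof (rule that[OF rpos(2) K])
    fix r :: real assume r: "r > 0"
    define s where "s = \<kappa> * r powr \<delta>"
    have s0: "s \<ge> 0" using \<kappa> by (simp add: s_def)
    define Q where "Q = L * (1 - s)\<^sup>2 / (1 + s) - 2 * \<delta> * s / (1 + s)\<^sup>2 - L / 4 * (1 + s)"
    note Qb = lyapunov_bound[OF L \<delta> s0, folded Q_def A_def]
    have "(L / 4 - Q) * (r powr (- M) * exp (- k * r powr \<delta>)) \<le> (if r < R then K else 0)"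
    proof (cases "r0 < r \<and> r < R")
      case True
      have "s < s1" unfolding s_def rs(2)[symmetric] using True r \<kappa> \<delta> by (intro mult_strict_left_mono powr_less_mono2) auto
      then have "L / 4 * (1 + s) \<le> L / 4 * (1 + s1)" using L by (intro mult_left_mono) auto
      then have 1: "L / 4 - Q \<le> B" using Qb(3) unfolding B_def by linarith
      have 2: "r powr (- M) \<le> r0 powr (- M) + R powr (- M)"
      proof (cases "M \<ge> 0")
        case True
        then have "r powr (- M) \<le> r0 powr (- M)" using \<open>r0 < r \<and> r < R\<close> rpos by (intro powr_mono2') auto
        then show ?thesis by (simp add: add_increasing2)
      next
        case False
        then have "r powr (- M) \<le> R powr (- M)" using \<open>r0 < r \<and> r < R\<close> rpos by (intro powr_mono2) auto
        then show ?thesis by (simp add: add_increasing)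
      qed
      have "r powr (- M) * exp (- k * r powr \<delta>) \<le> r0 powr (- M) + R powr (- M)"
        using mult_mono[OF 2, of "exp (- k * r powr \<delta>)" 1] k by auto
      then have "(L / 4 - Q) * (r powr (- M) * exp (- k * r powr \<delta>)) \<le> B * (r0 powr (- M) + R powr (- M))"
        using 1 B by (intro mult_mono[OF 1]) auto
      then show ?thesis using True by (simp add: K_def)
    next
      case False
      have "L / 4 \<le> Q"
      proof (cases "r \<le> r0")
        case True
        have "s \<le> s0" unfolding s_def rs(1)[symmetric] using True r \<kappa> \<delta> by (intro mult_left_mono powr_mono2) auto
        then have "A * s \<le> A * s0" using A by (intro mult_left_mono) auto
        also have "\<dots> = L / 2" using A by (simp add: s0_def)
        finally show ?thesis using Qb(1) by linarith
      next
        case False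
        then have "s1 \<le> s" unfolding s_def rs(2)[symmetric] using \<open>\<not> (r0 < r \<and> r < R)\<close> rpos r \<kappa> \<delta> by (intro mult_left_mono powr_mono2) auto
        then have "3 / 4 * L * s1 \<le> 3 / 4 * L * s" using L by (intro mult_left_mono) auto
        moreover have "3 / 4 * L * s1 = A + L" using L by (simp add: s1_def)
        ultimately show ?thesis using Qb(2) L by linarith
      qed
      then have "(L / 4 - Q) * (r powr (- M) * exp (- k * r powr \<delta>)) \<le> 0"
        by (intro mult_nonpos_nonneg) auto
      then show ?thesis using K by auto
    qed
    then show "(L / 4 - (L * (1 - \<kappa> * r powr \<delta>)\<^sup>2 / (1 + \<kappa> * r powr \<delta>) - 2 * \<delta> * (\<kappa> * r powr \<delta>) / (1 + \<kappa> * r powr \<delta>)\<^sup>2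
        - L / 4 * (1 + \<kappa> * r powr \<delta>))) * (r powr (- M) * exp (- k * r powr \<delta>)) \<le> (if r < R then K else 0)"
      by (simp add: Q_def s_def)
  qed
qed

text \<open>The factor \<open>\<theta> = (1 - s) / (1 + s)\<close> changes sign from outward to inward and stays bounded by \<open>1\<close>. The
  boundedness matters: a factor growing at infinity would leave a gradient weight
  that dominates \<open>\<bar>x\<bar>\<^bsup>-pb\<^esup>\<close> there.\<close>

lemma radial_derivative_lyapunov_weight:
  fixes \<kappa> \<delta> k M r :: real
  assumes r: "r > 0" and \<kappa>: "\<kappa> > 0" and k: "k * \<delta> = p"
  defines "\<sigma> \<equiv> \<kappa> * r powr \<delta>"
  shows "((\<lambda>r. (1 - \<kappa> * r powr \<delta>) / (1 + \<kappa> * r powr \<delta>) * (r powr (- M) * exp (- k * r powr \<delta>)))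
    has_real_derivative
      (- 2 * \<delta> * \<sigma> / (1 + \<sigma>)\<^sup>2 - (p * r powr \<delta> + M) * ((1 - \<sigma>) / (1 + \<sigma>))) * (r powr (- M) * exp (- k * r powr \<delta>)) / r) (at r)"
proof -
  have pos: "1 + \<sigma> > 0" "1 + \<sigma> \<noteq> 0" unfolding \<sigma>_def using \<kappa> by (smt (verit) mult_nonneg_nonneg powr_ge_zero)+
  have s': "((\<lambda>r. \<kappa> * r powr \<delta>) has_real_derivative \<delta> * \<sigma> / r) (at r)"
    using r by (auto intro!: derivative_eq_intros simp: \<sigma>_def powr_diff)
  have "((\<lambda>r. (1 - \<kappa> * r powr \<delta>) / (1 + \<kappa> * r powr \<delta>)) has_real_derivative
      ((0 - \<delta> * \<sigma> / r) * (1 + \<sigma>) - (1 - \<sigma>) * (0 + \<delta> * \<sigma> / r)) / ((1 + \<sigma>) * (1 + \<sigma>))) (at r)"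
    unfolding \<sigma>_def using pos
    by (intro DERIV_divide DERIV_diff DERIV_add DERIV_const s'[unfolded \<sigma>_def]) (auto simp: \<sigma>_def)
  moreover have "((0 - \<delta> * \<sigma> / r) * (1 + \<sigma>) - (1 - \<sigma>) * (0 + \<delta> * \<sigma> / r)) / ((1 + \<sigma>) * (1 + \<sigma>)) = (- 2 * \<delta> * \<sigma> / (1 + \<sigma>)\<^sup>2) / r"
    using r by (simp add: power2_eq_square divide_simps) (simp add: algebra_simps)
  ultimately have \<theta>': "((\<lambda>r. (1 - \<kappa> * r powr \<delta>) / (1 + \<kappa> * r powr \<delta>)) has_real_derivative (- 2 * \<delta> * \<sigma> / (1 + \<sigma>)\<^sup>2) / r) (at r)"
    by simp
  have m': "((\<lambda>r. r powr (- M) * exp (- k * r powr \<delta>)) has_real_derivative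
      - (p * r powr \<delta> + M) * (r powr (- M) * exp (- k * r powr \<delta>)) / r) (at r)"
    unfolding k[symmetric] using r
    by (auto intro!: derivative_eq_intros simp: powr_diff powr_minus divide_simps) (simp add: algebra_simps)
  have gen: "A / r * y + - B * y / r * t = (A - B * t) * y / r" for A B y t :: real
    by (simp add: divide_inverse algebra_simps)
  show ?thesis
    by (rule DERIV_cong[OF DERIV_mult[OF \<theta>' m']]) (simp only: \<sigma>_def[symmetric] gen)
qed

lemma gradient_eq_0_where_constant:
  fixes v :: "'a::euclidean_space \<Rightarrow> real"
  assumes v': "(v has_derivative (\<lambda>h. g \<bullet> h)) (at x)" and U: "open U" "x \<in> U" "\<And>y. y \<in> U \<Longrightarrow> v y = 0"
  shows "g = 0"
proof -
  have "((\<lambda>_. 0) has_derivative (\<lambda>h. g \<bullet> h)) (at x)"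
    by (rule has_derivative_transform_within_open[OF v' U(1,2)]) (use U in auto)
  then have "(\<lambda>h. g \<bullet> h) = (\<lambda>h. 0)"
    using has_derivative_unique has_derivative_const by blast
  then show ?thesis by (metis inner_eq_zero_iff)
qed

text \<open>Take \<open>f = v - c\<close> in \<open>integral_radial_weight\<close> with \<open>h = \<theta> m\<close>, where \<open>m\<close> is the full weight and
  \<open>\<kappa> = p / L\<close>, \<open>L = N - M\<close>. This \<open>\<kappa>\<close> makes the contribution of \<open>m\<close> to the divergence \<open>L (1 - s) \<theta> m\<close>, which has the
  sign of a square. Young's inequality absorbs \<open>f\<close> into the divergence and leaves the gradient with the
  weight \<open>\<bar>x\<bar>\<^bsup>p - (p-1)\<delta> - M\<^esup>\<close>, and this is \<open>\<bar>x\<bar>\<^bsup>-pb\<^esup>\<close> by the relation between the parameters.\<close>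

lemma weighted_poincare:
  fixes p b \<delta> M :: real
  assumes p: "p \<ge> 2" and b: "b \<ge> 0" and \<delta>: "\<delta> > 0" and M: "M < real DIM('a::euclidean_space)"
    and rel: "(p - 1) * \<delta> = p + p * b - M"
  shows "\<exists>C>0. \<forall>(v :: 'a \<Rightarrow> real) G r R.
    (\<forall>x. (v has_derivative (\<lambda>h. G x \<bullet> h)) (at x)) \<longrightarrow> continuous_on UNIV G \<longrightarrow> 0 < r \<longrightarrow>
    (\<forall>x. norm x < r \<or> R < norm x \<longrightarrow> v x = 0) \<longrightarrow>
    (\<exists>c. (\<integral>x. \<bar>v x - c\<bar> powr p * (norm x powr (- M) * exp (- (p / \<delta>) * norm x powr \<delta>)) \<partial>lborel)
      \<le> C * (\<integral>x. norm (G x) powr p * (norm x powr (- (p * b)) * exp (- (p / \<delta>) * norm x powr \<delta>)) \<partial>lborel))"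
proof -
  let ?n = "real DIM('a)"
  define L where "L = ?n - M"
  have L: "L > 0" using M by (simp add: L_def)
  define \<kappa> where "\<kappa> = p / L"
  have \<kappa>: "\<kappa> > 0" "L * \<kappa> = p" using L p by (auto simp: \<kappa>_def)
  define k where "k = p / \<delta>"
  have k: "k > 0" "k * \<delta> = p" using p \<delta> by (auto simp: k_def)
  define W where "W = (\<lambda>r. exp (- k * r powr \<delta>))"
  define m where "m = (\<lambda>r. r powr (- M) * W r)"
  define s where "s = (\<lambda>r. \<kappa> * r powr \<delta>)"
  define \<theta> where "\<theta> = (\<lambda>r. (1 - s r) / (1 + s r))"
  define h' where "h' = (\<lambda>r. (- 2 * \<delta> * s r / (1 + s r)\<^sup>2 - (p * r powr \<delta> + M) * \<theta> r) * m r / r)"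
  define Q0 where "Q0 = (\<lambda>r. L * (1 - s r)\<^sup>2 / (1 + s r) - 2 * \<delta> * s r / (1 + s r)\<^sup>2)"
  have s0: "s r \<ge> 0" for r using \<kappa> by (simp add: s_def)
  have s1: "1 + s r > 0" "1 + s r \<noteq> 0" for r using s0[of r] by linarith+
  have m0: "m r \<ge> 0" for r by (simp add: m_def W_def)
  have \<theta>1: "\<bar>\<theta> r\<bar> \<le> 1" for r
    unfolding \<theta>_def using s0[of r] by (simp add: abs_le_iff divide_simps)
  have hder: "((\<lambda>r. \<theta> r * m r) has_real_derivative h' r) (at r)" if "r > 0" for r
    using radial_derivative_lyapunov_weight[OF that \<kappa>(1) k(2), of M]
    unfolding \<theta>_def s_def m_def W_def h'_def by simp
  have h'c: "continuous_on {0<..} h'"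
    unfolding h'_def \<theta>_def m_def W_def
    using s1 by (intro continuous_intros continuous_on_powr') (auto simp: s_def intro!: continuous_intros continuous_on_powr')
  have div: "?n * (\<theta> r * m r) + r * h' r = Q0 r * m r" if r: "r > 0" for r
  proof -
    have "?n * (\<theta> r * m r) + r * h' r = (L * \<theta> r - p * r powr \<delta> * \<theta> r - 2 * \<delta> * s r / (1 + s r)\<^sup>2) * m r"
    proof -
      have "r * h' r = (- 2 * \<delta> * s r / (1 + s r)\<^sup>2 - (p * r powr \<delta> + M) * \<theta> r) * m r"
        using r by (simp add: h'_def)
      then show ?thesis by (simp add: L_def algebra_simps)
    qed
    also have "p * r powr \<delta> * \<theta> r = L * s r * \<theta> r" by (simp add: s_def \<kappa>(2)[symmetric])
    also have "L * \<theta> r - L * s r * \<theta> r = L * (1 - s r)\<^sup>2 / (1 + s r)"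
      by (simp add: \<theta>_def power2_eq_square algebra_simps diff_divide_distrib add_divide_distrib)
    finally show ?thesis by (simp add: Q0_def)
  qed
  define P where "P = (\<lambda>x::'a. (1 + norm x powr \<delta>) * m (norm x))"
  have P: "integrable lborel P"
    unfolding P_def m_def W_def by (rule integrable_stretched_exponential_weight[OF M \<delta> k(1)])
  have P0: "P x \<ge> 0" for x using m0 by (simp add: P_def)
  have dom: "integrable lborel F" if "F \<in> borel_measurable borel" and F: "\<And>x. \<bar>F x\<bar> \<le> C * P x" for F :: "'a \<Rightarrow> real" and C
  proof (rule Bochner_Integration.integrable_bound)
    show "integrable lborel (\<lambda>x. C * P x)" using P by simp
    show "AE x in lborel. norm (F x) \<le> norm (C * P x)"
      using order_trans[OF F abs_ge_self] by auto
  qed (use that in auto)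
  obtain R0 K where R0: "R0 > 0" and K: "K \<ge> 0"
    and QK: "\<And>r. r > 0 \<Longrightarrow> (L / 4 - (Q0 r - L / 4 * (1 + s r))) * m r \<le> (if r < R0 then K else 0)"
    using lyapunov_deficit_compact[OF L \<delta> \<kappa>(1) k(1), of M] unfolding Q0_def s_def m_def W_def by metis
  define C1 where "C1 = (p / (4 * (p - 1))) powr (- (p - 1))"
  define kB where "kB = 2 powr p * R0 powr p * 2 ^ DIM('a)"
  define C2 where "C2 = R0 powr (p * b) / W R0"
  define C where "C = (C1 + K * kB * C2) / (L / 4)"
  have Cpos: "C1 > 0" "kB > 0" "C2 > 0" using p R0 by (auto simp: C1_def kB_def C2_def W_def)
  have C: "C > 0" unfolding C_def using Cpos K L by (intro divide_pos_pos add_pos_nonneg) auto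
  have main: "\<exists>c. (\<integral>x. \<bar>v x - c\<bar> powr p * m (norm x) \<partial>lborel) \<le> C * (\<integral>x. norm (G x) powr p * (norm x powr (- (p * b)) * W (norm x)) \<partial>lborel)"
    if v': "\<And>x. (v has_derivative (\<lambda>h. G x \<bullet> h)) (at x)" and G: "continuous_on UNIV G" and r: "0 < r"
      and z: "\<And>x. norm x < r \<or> R < norm x \<Longrightarrow> v x = 0" for v :: "'a \<Rightarrow> real" and G r R
  proof -
    have Gz: "G x = 0" if "norm x < r \<or> R < norm x" for x
    proof (rule gradient_eq_0_where_constant[OF v'])
      show "open ({x::'a. norm x < r} \<union> {x. R < norm x})"
        by (intro open_Un open_Collect_less continuous_intros)
    qed (use that z in auto)
    have vc: "continuous_on UNIV v"
      using v' by (auto simp: continuous_on_eq_continuous_at intro: has_derivative_continuous)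
    obtain V where V: "\<And>x. \<bar>v x\<bar> \<le> V"
    proof -
      have "bounded (v ` cball 0 R)"
        by (intro compact_imp_bounded compact_continuous_image continuous_on_subset[OF vc]) auto
      then obtain B where "\<And>x. x \<in> cball 0 R \<Longrightarrow> \<bar>v x\<bar> \<le> B"
        unfolding bounded_iff real_norm_def by blast
      then have "\<bar>v x\<bar> \<le> max B 0" for x using z[of x] by (cases "norm x \<le> R") (auto simp: le_max_iff_disj)
      then show ?thesis using that by blast
    qed
    have [measurable]: "v \<in> borel_measurable borel" "G \<in> borel_measurable borel"
      using vc G by (auto intro!: borel_measurable_continuous_onI)
    define E where "E = (\<integral>x. norm (G x) powr p * (norm x powr (- (p * b)) * W (norm x)) \<partial>lborel)"
    have Eint: "integrable lborel (\<lambda>x. norm (G x) powr p * (norm x powr (- (p * b)) * W (norm x)))"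
    proof (rule integrable_vanish_outside_annulus[OF _ r, of _ R])
      show "continuous_on (- {0}) (\<lambda>x. norm (G x) powr p * (norm x powr (- (p * b)) * W (norm x)))"
        unfolding W_def using p \<delta> by (intro continuous_intros continuous_on_powr' continuous_on_subset[OF G]) auto
    qed (use Gz in auto)
    have E0: "E \<ge> 0" unfolding E_def by (intro integral_nonneg_AE) (auto simp: W_def)
    obtain c where c: "(\<integral>\<^sup>+y. ennreal (\<bar>v y - c\<bar> powr p) * indicator (ball 0 R0) y \<partial>lborel)
      \<le> ennreal kB * (\<integral>\<^sup>+y. ennreal (norm (G y) powr p) * indicator (ball 0 R0) y \<partial>lborel)"
      using nn_integral_ball_poincare[of p R0 v G] p R0 v' G unfolding kB_def by auto
    define f where "f = (\<lambda>x. v x - c)"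
    have f': "(f has_derivative (\<lambda>h. G x \<bullet> h)) (at x)" for x
      unfolding f_def by (rule has_derivative_eq_rhs[OF has_derivative_diff[OF v' has_derivative_const]]) auto
    have fc: "continuous_on UNIV f" unfolding f_def by (intro continuous_intros vc)
    have [measurable]: "f \<in> borel_measurable borel" unfolding f_def by measurable
    define F where "F = (V + \<bar>c\<bar>) powr p"
    have F: "\<bar>f x\<bar> powr p \<le> F" for x
      unfolding F_def f_def using V[of x] p by (intro powr_mono2) auto
    have F0: "F \<ge> 0" by (simp add: F_def)
    have s\<kappa>: "1 + s (norm x) \<le> (1 + \<kappa>) * (1 + norm x powr \<delta>)" for x :: 'a
      using \<kappa> by (simp add: s_def algebra_simps)
    have i_m: "integrable lborel (\<lambda>x. \<bar>f x\<bar> powr p * m (norm x))"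
    proof (rule dom[of _ F])
      fix x
      have "\<bar>f x\<bar> powr p * m (norm x) \<le> F * ((1 + norm x powr \<delta>) * m (norm x))"
        using F F0 m0[of "norm x"] by (intro mult_mono) (auto intro: mult_left_le_one_le simp: algebra_simps)
      then show "\<bar>\<bar>f x\<bar> powr p * m (norm x)\<bar> \<le> F * P x" using m0[of "norm x"] by (simp add: P_def abs_mult)
    qed (unfold m_def W_def, measurable)
    have i_sm: "integrable lborel (\<lambda>x. \<bar>f x\<bar> powr p * ((1 + s (norm x)) * m (norm x)))"
    proof (rule dom[of _ "F * (1 + \<kappa>)"])
      fix x
      have "\<bar>f x\<bar> powr p * ((1 + s (norm x)) * m (norm x)) \<le> F * (((1 + \<kappa>) * (1 + norm x powr \<delta>)) * m (norm x))"
        using F F0 m0[of "norm x"] s1[of "norm x"] s\<kappa>[of x] by (intro mult_mono) auto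
      then show "\<bar>\<bar>f x\<bar> powr p * ((1 + s (norm x)) * m (norm x))\<bar> \<le> F * (1 + \<kappa>) * P x"
        using m0[of "norm x"] s1[of "norm x"] by (simp add: P_def abs_mult mult_ac)
    qed (unfold m_def W_def s_def, measurable)
    have i1: "integrable lborel (\<lambda>x. \<bar>f x\<bar> powr p * (\<theta> (norm x) * m (norm x)))"
    proof (rule Bochner_Integration.integrable_bound[OF i_m])
      show "AE x in lborel. norm (\<bar>f x\<bar> powr p * (\<theta> (norm x) * m (norm x))) \<le> norm (\<bar>f x\<bar> powr p * m (norm x))"
        using mult_right_mono[OF \<theta>1 m0] m0 by (auto simp: abs_mult intro!: mult_left_mono)
    qed (unfold m_def W_def s_def \<theta>_def, measurable)
    have h'b: "\<bar>r * h' r\<bar> \<le> (2 * \<delta> + p + \<bar>M\<bar>) * ((1 + r powr \<delta>) * m r)" if "r \<ge> 0" for r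
    proof -
      have 1: "s r / (1 + s r)\<^sup>2 \<le> 1"
        using s0[of r] by (simp add: divide_simps power2_eq_square algebra_simps)
      have "\<bar>- 2 * \<delta> * s r / (1 + s r)\<^sup>2 - (p * r powr \<delta> + M) * \<theta> r\<bar>
        \<le> 2 * \<delta> * (s r / (1 + s r)\<^sup>2) + \<bar>p * r powr \<delta> + M\<bar> * \<bar>\<theta> r\<bar>"
        using abs_triangle_ineq4[of "- 2 * \<delta> * s r / (1 + s r)\<^sup>2" "(p * r powr \<delta> + M) * \<theta> r"] \<delta> s0[of r]
        by (simp add: abs_mult)
      also have "\<dots> \<le> 2 * \<delta> * 1 + (p * r powr \<delta> + \<bar>M\<bar>) * 1"
        using 1 \<theta>1[of r] \<delta> p by (intro add_mono mult_mono mult_left_mono) (auto intro: order_trans[OF abs_triangle_ineq])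
      also have "\<dots> \<le> (2 * \<delta> + p + \<bar>M\<bar>) * (1 + r powr \<delta>)"
        using \<delta> p by (simp add: algebra_simps)
      finally have "\<bar>- 2 * \<delta> * s r / (1 + s r)\<^sup>2 - (p * r powr \<delta> + M) * \<theta> r\<bar> * m r \<le> (2 * \<delta> + p + \<bar>M\<bar>) * (1 + r powr \<delta>) * m r"
        using m0 by (intro mult_right_mono) auto
      moreover have "\<bar>r * h' r\<bar> \<le> \<bar>- 2 * \<delta> * s r / (1 + s r)\<^sup>2 - (p * r powr \<delta> + M) * \<theta> r\<bar> * m r"
        using m0[of r] that by (cases "r = 0") (auto simp: h'_def abs_mult)
      ultimately show ?thesis by (simp add: mult_ac)
    qed
    have i2: "integrable lborel (\<lambda>x. \<bar>f x\<bar> powr p * (norm x * h' (norm x)))"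
    proof (rule dom[of _ "F * (2 * \<delta> + p + \<bar>M\<bar>)"])
      fix x
      have "\<bar>\<bar>f x\<bar> powr p * (norm x * h' (norm x))\<bar> \<le> F * ((2 * \<delta> + p + \<bar>M\<bar>) * ((1 + norm x powr \<delta>) * m (norm x)))"
        using F F0 h'b[of "norm x"] unfolding abs_mult[of "\<bar>f x\<bar> powr p"] by (intro mult_mono) auto
      then show "\<bar>\<bar>f x\<bar> powr p * (norm x * h' (norm x))\<bar> \<le> F * (2 * \<delta> + p + \<bar>M\<bar>) * P x"
        by (simp add: P_def mult_ac)
    qed (unfold m_def W_def s_def \<theta>_def h'_def, measurable)
    have i3: "integrable lborel (\<lambda>x. \<bar>f x\<bar> powr (p - 2) * f x * (G x \<bullet> x) * (\<theta> (norm x) * m (norm x)))"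
    proof (rule integrable_vanish_outside_annulus[OF _ r, of _ R])
      have c1: "continuous_on S (\<lambda>x. \<bar>f x\<bar> powr (p - 2) * f x)" for S
        using continuous_on_compose2[OF continuous_abs_powr_times[OF p] fc] continuous_on_subset by auto
      show "continuous_on (- {0}) (\<lambda>x. \<bar>f x\<bar> powr (p - 2) * f x * (G x \<bullet> x) * (\<theta> (norm x) * m (norm x)))"
        unfolding \<theta>_def m_def W_def using s1 \<delta>
        by (intro continuous_intros c1 continuous_on_powr' continuous_on_subset[OF G])
           (auto simp: s_def intro!: continuous_intros continuous_on_powr')
    qed (use Gz in auto)
    have id: "(\<integral>x. \<bar>f x\<bar> powr p * (?n * (\<theta> (norm x) * m (norm x)) + norm x * h' (norm x)) \<partial>lborel)
      = - p * (\<integral>x. \<bar>f x\<bar> powr (p - 2) * f x * (G x \<bullet> x) * (\<theta> (norm x) * m (norm x)) \<partial>lborel)"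
      by (rule integral_radial_weight[OF p f' G hder h'c i1 i2 i3])
    let ?lhs = "\<lambda>x. \<bar>f x\<bar> powr p * (?n * (\<theta> (norm x) * m (norm x)) + norm x * h' (norm x))"
    let ?rhs = "\<lambda>x. \<bar>f x\<bar> powr (p - 2) * f x * (G x \<bullet> x) * (\<theta> (norm x) * m (norm x))"
    let ?e = "\<lambda>x. norm (G x) powr p * (norm x powr (- (p * b)) * W (norm x))"
    have pw: "- p * ?rhs x \<le> L / 4 * (\<bar>f x\<bar> powr p * ((1 + s (norm x)) * m (norm x))) + C1 * ?e x" if x: "x \<noteq> 0" for x
    proof -
      \<comment> \<open>Young's parameter: it makes the absorbed term exactly \<open>L / 4\<close> times \<open>1 + s\<close>.\<close>
      define T where "T = L * (1 + s (norm x)) / (4 * (p - 1))"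
      have T: "T > 0" unfolding T_def using L s1 p by auto
      have fp: "\<bar>\<bar>f x\<bar> powr (p - 2) * f x\<bar> = \<bar>f x\<bar> powr (p - 1)"
        using p powr_add[of "\<bar>f x\<bar>" "p - 2" 1] by (cases "f x = 0") (auto simp: abs_mult)
      have "- p * ?rhs x \<le> \<bar>- p * ?rhs x\<bar>" by (rule abs_ge_self)
      also have "\<dots> = p * (\<bar>f x\<bar> powr (p - 1) * \<bar>G x \<bullet> x\<bar> * (\<bar>\<theta> (norm x)\<bar> * m (norm x)))"
        unfolding abs_mult fp[unfolded abs_mult] using p m0[of "norm x"] by simp
      also have "\<dots> \<le> p * (\<bar>f x\<bar> powr (p - 1) * (norm (G x) * norm x) * (1 * m (norm x)))"
        using p m0[of "norm x"] \<theta>1[of "norm x"] Cauchy_Schwarz_ineq2[of "G x" x]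
        by (intro mult_left_mono mult_mono) auto
      also have "\<dots> = p * \<bar>f x\<bar> powr (p - 1) * (norm (G x) * norm x) * m (norm x)" by simp
      also have "\<dots> \<le> ((p - 1) * T * \<bar>f x\<bar> powr p + T powr (- (p - 1)) * (norm (G x) * norm x) powr p) * m (norm x)"
        using m0 by (intro mult_right_mono young_powr[OF p _ _ T]) auto
      also have "\<dots> = L / 4 * (\<bar>f x\<bar> powr p * ((1 + s (norm x)) * m (norm x))) + T powr (- (p - 1)) * (norm (G x) * norm x) powr p * m (norm x)"
        using p by (simp add: T_def field_simps)
      also have "T powr (- (p - 1)) * (norm (G x) * norm x) powr p * m (norm x) \<le> C1 * ?e x"
      proof -
        have "p / (4 * (p - 1)) * norm x powr \<delta> \<le> T"
        proof -
          have "L * (1 + s (norm x)) = L + (L * \<kappa>) * norm x powr \<delta>" by (simp add: s_def algebra_simps)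
          then have "p * norm x powr \<delta> \<le> L * (1 + s (norm x))" using L \<kappa>(2) by simp
          then have "p * norm x powr \<delta> / (4 * (p - 1)) \<le> T" unfolding T_def using p by (intro divide_right_mono) auto
          then show ?thesis by simp
        qed
        then have "T powr (- (p - 1)) \<le> (p / (4 * (p - 1)) * norm x powr \<delta>) powr (- (p - 1))"
          using p x by (intro powr_mono2') auto
        also have "\<dots> = C1 * norm x powr (- (\<delta> * (p - 1)))"
          unfolding powr_mult powr_powr C1_def by (simp add: right_diff_distrib)
        finally have "T powr (- (p - 1)) * (norm (G x) * norm x) powr p * m (norm x)
          \<le> (C1 * norm x powr (- (\<delta> * (p - 1)))) * (norm (G x) * norm x) powr p * m (norm x)"
          using m0 by (intro mult_right_mono) auto
        also have "\<dots> = C1 * (norm (G x) powr p * ((norm x powr (- (\<delta> * (p - 1))) * norm x powr p * norm x powr (- M)) * W (norm x)))"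
          by (simp add: powr_mult m_def)
        also have "norm x powr (- (\<delta> * (p - 1))) * norm x powr p * norm x powr (- M) = norm x powr (- (p * b))"
        proof -
          have "- (\<delta> * (p - 1)) + p + - M = - (p * b)" using rel by (simp add: algebra_simps)
          then show ?thesis using x by (metis powr_add)
        qed
        finally show ?thesis .
      qed
      finally show ?thesis by simp
    qed
    have iQ: "integrable lborel ?lhs"
      using Bochner_Integration.integrable_add[OF integrable_mult_right[OF i1, of ?n] i2] by (simp add: algebra_simps)
    have step1: "(\<integral>x. ?lhs x \<partial>lborel) \<le> L / 4 * (\<integral>x. \<bar>f x\<bar> powr p * ((1 + s (norm x)) * m (norm x)) \<partial>lborel) + C1 * E"
    proof -
      have "(\<integral>x. ?lhs x \<partial>lborel) = (\<integral>x. - p * ?rhs x \<partial>lborel)"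
        unfolding id by simp
      also have "\<dots> \<le> (\<integral>x. L / 4 * (\<bar>f x\<bar> powr p * ((1 + s (norm x)) * m (norm x))) + C1 * ?e x \<partial>lborel)"
      proof (rule integral_mono_AE)
        show "integrable lborel (\<lambda>x. - p * ?rhs x)" using i3 by (intro integrable_mult_right) auto
        show "integrable lborel (\<lambda>x. L / 4 * (\<bar>f x\<bar> powr p * ((1 + s (norm x)) * m (norm x))) + C1 * ?e x)"
          using i_sm Eint by (intro Bochner_Integration.integrable_add integrable_mult_right) auto
        show "AE x in lborel. - p * ?rhs x \<le> L / 4 * (\<bar>f x\<bar> powr p * ((1 + s (norm x)) * m (norm x))) + C1 * ?e x"
          using AE_lborel_singleton[of 0] by eventually_elim (rule pw)
      qed
      also have "\<dots> = L / 4 * (\<integral>x. \<bar>f x\<bar> powr p * ((1 + s (norm x)) * m (norm x)) \<partial>lborel) + C1 * E"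
        unfolding E_def using i_sm Eint
        by (subst Bochner_Integration.integral_add) (auto intro!: integrable_mult_right simp del: times_divide_eq_left)
      finally show ?thesis .
    qed
    \<comment> \<open>Since \<open>b \<ge> 0\<close>, the gradient weight decreases in \<open>\<bar>x\<bar>\<close>; \<open>1 / C2\<close> is its value on the boundary of the ball.\<close>
    have ballG: "(\<integral>\<^sup>+y. ennreal (norm (G y) powr p) * indicator (ball 0 R0) y \<partial>lborel) \<le> ennreal (C2 * E)"
    proof -
      have "(\<integral>\<^sup>+y. ennreal (norm (G y) powr p) * indicator (ball 0 R0) y \<partial>lborel) \<le> (\<integral>\<^sup>+y. ennreal (C2 * ?e y) \<partial>lborel)"
      proof (rule nn_integral_mono)
        fix y
        show "ennreal (norm (G y) powr p) * indicator (ball 0 R0) y \<le> ennreal (C2 * ?e y)"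
        proof (cases "y \<in> ball 0 R0 \<and> y \<noteq> 0")
          case True
          have "1 = C2 * (R0 powr (- (p * b)) * W R0)"
            using R0 by (simp add: C2_def W_def powr_minus)
          also have "\<dots> \<le> C2 * (norm y powr (- (p * b)) * W (norm y))"
          proof (intro mult_left_mono mult_mono)
            show "R0 powr (- (p * b)) \<le> norm y powr (- (p * b))"
              using True p b by (intro powr_mono2') auto
            have "norm y powr \<delta> \<le> R0 powr \<delta>" using True \<delta> by (intro powr_mono2) auto
            then show "W R0 \<le> W (norm y)" using k by (simp add: W_def)
          qed (use Cpos in \<open>auto simp: W_def\<close>)
          finally have "norm (G y) powr p * 1 \<le> norm (G y) powr p * (C2 * (norm y powr (- (p * b)) * W (norm y)))"
            by (intro mult_left_mono) auto
          then have "norm (G y) powr p \<le> C2 * ?e y" by (simp add: mult_ac)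
          then show ?thesis using True by (simp add: ennreal_leI)
        next
          case False
          then show ?thesis using Gz[of 0] r by (auto split: split_indicator)
        qed
      qed
      also have "\<dots> = ennreal (\<integral>y. C2 * ?e y \<partial>lborel)"
        using Cpos Eint by (intro nn_integral_eq_integral integrable_mult_right) (auto simp: W_def)
      also have "(\<integral>y. C2 * ?e y \<partial>lborel) = C2 * E" by (simp add: E_def)
      finally show ?thesis .
    qed
    have ballf_int: "integrable lborel (\<lambda>y. \<bar>f y\<bar> powr p * indicator (ball 0 R0) y)"
    proof (rule Bochner_Integration.integrable_bound[of lborel "\<lambda>y. F * indicator (ball 0 R0) y"])
      show "integrable lborel (\<lambda>y::'a. F * indicator (ball 0 R0) y :: real)"
        using emeasure_bounded_finite[of "ball (0::'a) R0"] by (intro integrable_mult_right integrable_real_indicator) auto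
      have [measurable]: "ball (0::'a) R0 \<in> sets borel" by simp
      show "(\<lambda>y. \<bar>f y\<bar> powr p * indicator (ball 0 R0) y) \<in> borel_measurable lborel" by measurable
      show "AE y in lborel. norm (\<bar>f y\<bar> powr p * indicator (ball 0 R0) y) \<le> norm (F * indicator (ball 0 R0) y)"
        using F F0 by (auto split: split_indicator)
    qed
    have ballf: "(\<integral>y. \<bar>f y\<bar> powr p * indicator (ball 0 R0) y \<partial>lborel) \<le> kB * (C2 * E)"
    proof -
      have "ennreal (\<integral>y. \<bar>f y\<bar> powr p * indicator (ball 0 R0) y \<partial>lborel) = (\<integral>\<^sup>+y. ennreal (\<bar>f y\<bar> powr p * indicator (ball 0 R0) y) \<partial>lborel)"
        by (rule nn_integral_eq_integral[symmetric, OF ballf_int]) auto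
      also have "\<dots> = (\<integral>\<^sup>+y. ennreal (\<bar>v y - c\<bar> powr p) * indicator (ball 0 R0) y \<partial>lborel)"
        by (simp add: f_def ennreal_mult'' ennreal_indicator)
      also have "\<dots> \<le> ennreal kB * ennreal (C2 * E)"
        using order_trans[OF c mult_left_mono[OF ballG]] by simp
      also have "\<dots> = ennreal (kB * (C2 * E))" using Cpos by (simp add: ennreal_mult')
      finally show ?thesis using Cpos E0 by (simp add: ennreal_le_iff)
    qed
    have "L / 4 * (\<integral>x. \<bar>f x\<bar> powr p * m (norm x) \<partial>lborel) - (\<integral>x. ?lhs x \<partial>lborel) + L / 4 * (\<integral>x. \<bar>f x\<bar> powr p * ((1 + s (norm x)) * m (norm x)) \<partial>lborel)
      = (\<integral>x. L / 4 * (\<bar>f x\<bar> powr p * m (norm x)) - ?lhs x + L / 4 * (\<bar>f x\<bar> powr p * ((1 + s (norm x)) * m (norm x))) \<partial>lborel)"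
      using i_m i_sm iQ
      by (subst Bochner_Integration.integral_add, (auto intro!: Bochner_Integration.integrable_diff integrable_mult_right simp del: times_divide_eq_left)[2],
          subst Bochner_Integration.integral_diff, (auto intro!: integrable_mult_right simp del: times_divide_eq_left)[2]) simp
    also have "\<dots> \<le> (\<integral>x. K * (\<bar>f x\<bar> powr p * indicator (ball 0 R0) x) \<partial>lborel)"
    proof (rule integral_mono_AE)
      show "integrable lborel (\<lambda>x. L / 4 * (\<bar>f x\<bar> powr p * m (norm x)) - ?lhs x + L / 4 * (\<bar>f x\<bar> powr p * ((1 + s (norm x)) * m (norm x))))"
        by (intro Bochner_Integration.integrable_add Bochner_Integration.integrable_diff integrable_mult_right i_m iQ i_sm)
      show "integrable lborel (\<lambda>x. K * (\<bar>f x\<bar> powr p * indicator (ball 0 R0) x))"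
        by (intro integrable_mult_right ballf_int)
      show "AE x in lborel. L / 4 * (\<bar>f x\<bar> powr p * m (norm x)) - ?lhs x + L / 4 * (\<bar>f x\<bar> powr p * ((1 + s (norm x)) * m (norm x)))
        \<le> K * (\<bar>f x\<bar> powr p * indicator (ball 0 R0) x)"
        using AE_lborel_singleton[of 0]
      proof eventually_elim
        case (elim x)
        then have x: "norm x > 0" by simp
        have "L / 4 * (\<bar>f x\<bar> powr p * m (norm x)) - ?lhs x + L / 4 * (\<bar>f x\<bar> powr p * ((1 + s (norm x)) * m (norm x)))
          = \<bar>f x\<bar> powr p * ((L / 4 - (Q0 (norm x) - L / 4 * (1 + s (norm x)))) * m (norm x))"
          unfolding div[OF x] by (simp add: field_simps)
        also have "\<dots> \<le> \<bar>f x\<bar> powr p * (if norm x < R0 then K else 0)"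
          by (intro mult_left_mono QK x) auto
        also have "\<dots> = K * (\<bar>f x\<bar> powr p * indicator (ball 0 R0) x)" by simp
        finally show ?case .
      qed
    qed
    also have "\<dots> = K * (\<integral>x. \<bar>f x\<bar> powr p * indicator (ball 0 R0) x \<partial>lborel)" by simp
    also have "\<dots> \<le> K * (kB * (C2 * E))"
      using K ballf by (intro mult_left_mono)
    finally have "L / 4 * (\<integral>x. \<bar>f x\<bar> powr p * m (norm x) \<partial>lborel) \<le> C1 * E + K * (kB * (C2 * E))"
      using step1 by linarith
    then have "(\<integral>x. \<bar>f x\<bar> powr p * m (norm x) \<partial>lborel) \<le> C * E"
      using L by (simp add: C_def field_simps)
    then show ?thesis unfolding f_def E_def by blast
  qed
  show ?thesis
  proof (rule exI[of _ C], intro conjI C allI impI)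
    fix v :: "'a \<Rightarrow> real" and G r R
    assume "\<forall>x. (v has_derivative (\<lambda>h. G x \<bullet> h)) (at x)" "continuous_on UNIV G" "0 < r"
      "\<forall>x. norm x < r \<or> R < norm x \<longrightarrow> v x = 0"
    then show "\<exists>c. (\<integral>x. \<bar>v x - c\<bar> powr p * (norm x powr (- M) * exp (- (p / \<delta>) * norm x powr \<delta>)) \<partial>lborel)
      \<le> C * (\<integral>x. norm (G x) powr p * (norm x powr (- (p * b)) * exp (- (p / \<delta>) * norm x powr \<delta>)) \<partial>lborel)"
      using main[of v G r R] unfolding m_def W_def k_def by auto
  qed
qed

text \<open>The dilation by \<open>t = \<mu>\<^bsup>-1/\<delta>\<^esup>\<close> normalises the exponential; both sides are homogeneous, and the
  quotient of their factors is \<open>t\<^bsup>p + pb - M\<^esup> = \<mu>\<^bsup>-(p-1)\<^esup>\<close>. This power of \<open>\<mu>\<close> is the one by which the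
  additive form of the inequality is divided in \<open>ckn_stability\<close>.\<close>

lemma weighted_poincare_scaled:
  fixes p b \<delta> M :: real
  assumes p: "p \<ge> 2" and b: "b \<ge> 0" and \<delta>: "\<delta> > 0" and M: "M < real DIM('a::euclidean_space)"
    and rel: "(p - 1) * \<delta> = p + p * b - M"
  shows "\<exists>C>0. \<forall>(v :: 'a \<Rightarrow> real) G r R \<mu>.
    (\<forall>x. (v has_derivative (\<lambda>h. G x \<bullet> h)) (at x)) \<longrightarrow> continuous_on UNIV G \<longrightarrow> 0 < r \<longrightarrow>
    (\<forall>x. norm x < r \<or> R < norm x \<longrightarrow> v x = 0) \<longrightarrow> 0 < \<mu> \<longrightarrow>
    (\<exists>c. \<mu> powr (p - 1) * (\<integral>x. \<bar>v x - c\<bar> powr p * (norm x powr (- M) * exp (- (\<mu> * p / \<delta>) * norm x powr \<delta>)) \<partial>lborel)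
      \<le> C * (\<integral>x. norm (G x) powr p * (norm x powr (- (p * b)) * exp (- (\<mu> * p / \<delta>) * norm x powr \<delta>)) \<partial>lborel))"
proof -
  let ?n = "real DIM('a)"
  obtain C where C: "C > 0" and wp: "\<forall>(v :: 'a \<Rightarrow> real) G r R.
    (\<forall>x. (v has_derivative (\<lambda>h. G x \<bullet> h)) (at x)) \<longrightarrow> continuous_on UNIV G \<longrightarrow> 0 < r \<longrightarrow>
    (\<forall>x. norm x < r \<or> R < norm x \<longrightarrow> v x = 0) \<longrightarrow>
    (\<exists>c. (\<integral>x. \<bar>v x - c\<bar> powr p * (norm x powr (- M) * exp (- (p / \<delta>) * norm x powr \<delta>)) \<partial>lborel)
      \<le> C * (\<integral>x. norm (G x) powr p * (norm x powr (- (p * b)) * exp (- (p / \<delta>) * norm x powr \<delta>)) \<partial>lborel))"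
    using weighted_poincare[OF p b \<delta> M rel] by (elim exE conjE)
  have "\<exists>c. \<mu> powr (p - 1) * (\<integral>x. \<bar>v x - c\<bar> powr p * (norm x powr (- M) * exp (- (\<mu> * p / \<delta>) * norm x powr \<delta>)) \<partial>lborel)
      \<le> C * (\<integral>x. norm (G x) powr p * (norm x powr (- (p * b)) * exp (- (\<mu> * p / \<delta>) * norm x powr \<delta>)) \<partial>lborel)"
    if v': "\<And>x. (v has_derivative (\<lambda>h. G x \<bullet> h)) (at x)" and G: "continuous_on UNIV G" and r: "0 < r"
      and z: "\<And>x. norm x < r \<or> R < norm x \<Longrightarrow> v x = 0" and l: "0 < \<mu>" for v :: "'a \<Rightarrow> real" and G r R \<mu>
  proof -
    define t where "t = \<mu> powr (- 1 / \<delta>)"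
    have t: "t > 0" using l by (simp add: t_def)
    have "t powr \<delta> = \<mu> powr (- 1)" unfolding t_def powr_powr using \<delta> by simp
    then have t\<delta>: "\<mu> * t powr \<delta> = 1" using l by (simp add: powr_minus)
    define vt where "vt = (\<lambda>x. v (t *\<^sub>R x))"
    define Gt where "Gt = (\<lambda>x. t *\<^sub>R G (t *\<^sub>R x))"
    have 1: "\<forall>x. (vt has_derivative (\<lambda>h. Gt x \<bullet> h)) (at x)"
    proof
      fix x
      have "((\<lambda>x. v (t *\<^sub>R x)) has_derivative (\<lambda>h. G (t *\<^sub>R x) \<bullet> (t *\<^sub>R h))) (at x)"
        by (rule has_derivative_compose[where f="\<lambda>x. t *\<^sub>R x" and g=v, OF _ v']) (auto intro!: derivative_eq_intros)
      then show "(vt has_derivative (\<lambda>h. Gt x \<bullet> h)) (at x)" by (simp add: vt_def Gt_def)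
    qed
    have 2: "continuous_on UNIV Gt"
      unfolding Gt_def by (intro continuous_intros continuous_on_compose2[OF G]) auto
    have 3: "\<forall>x. norm x < r / t \<or> R / t < norm x \<longrightarrow> vt x = 0"
      unfolding vt_def using t by (intro allI impI z) (auto simp: field_simps)
    have rt: "0 < r / t" using r t by simp
    obtain c where c: "(\<integral>x. \<bar>vt x - c\<bar> powr p * (norm x powr (- M) * exp (- (p / \<delta>) * norm x powr \<delta>)) \<partial>lborel)
      \<le> C * (\<integral>x. norm (Gt x) powr p * (norm x powr (- (p * b)) * exp (- (p / \<delta>) * norm x powr \<delta>)) \<partial>lborel)"
      using wp[THEN spec[of _ vt], THEN spec[of _ Gt], THEN spec[of _ "r / t"], THEN spec[of _ "R / t"],
          THEN mp, OF 1, THEN mp, OF 2, THEN mp, OF rt, THEN mp, OF 3] by (elim exE)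
    define \<Phi> where "\<Phi> = (\<lambda>x. \<bar>v x - c\<bar> powr p * (norm x powr (- M) * exp (- (\<mu> * p / \<delta>) * norm x powr \<delta>)))"
    define \<Psi> where "\<Psi> = (\<lambda>x. norm (G x) powr p * (norm x powr (- (p * b)) * exp (- (\<mu> * p / \<delta>) * norm x powr \<delta>)))"
    have ex: "exp (- (\<mu> * p / \<delta>) * norm (t *\<^sub>R x) powr \<delta>) = exp (- (p / \<delta>) * norm x powr \<delta>)" for x :: 'a
    proof -
      have "(\<mu> * p / \<delta>) * norm (t *\<^sub>R x) powr \<delta> = (\<mu> * t powr \<delta>) * ((p / \<delta>) * norm x powr \<delta>)"
        using t by (simp add: powr_mult)
      then show ?thesis unfolding t\<delta> by simp
    qed
    have tM: "t powr M * t powr (- M) = 1" "t powr (p * b) * t powr (- (p * b)) = 1"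
      using t by (simp_all flip: powr_add)
    have e1: "\<bar>vt x - c\<bar> powr p * (norm x powr (- M) * exp (- (p / \<delta>) * norm x powr \<delta>)) = t powr M * \<Phi> (t *\<^sub>R x)" for x
    proof -
      have "t powr M * \<Phi> (t *\<^sub>R x) = (t powr M * t powr (- M)) * (\<bar>vt x - c\<bar> powr p * (norm x powr (- M) * exp (- (p / \<delta>) * norm x powr \<delta>)))"
        unfolding \<Phi>_def vt_def ex using t by (simp add: powr_mult)
      then show ?thesis unfolding tM by simp
    qed
    have e2: "norm (Gt x) powr p * (norm x powr (- (p * b)) * exp (- (p / \<delta>) * norm x powr \<delta>)) = t powr (p + p * b) * \<Psi> (t *\<^sub>R x)" for x
    proof -
      have "t powr (p + p * b) * \<Psi> (t *\<^sub>R x) = (t powr (p * b) * t powr (- (p * b))) * (norm (Gt x) powr p * (norm x powr (- (p * b)) * exp (- (p / \<delta>) * norm x powr \<delta>)))"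
        unfolding \<Psi>_def Gt_def ex using t by (simp add: powr_mult powr_add)
      then show ?thesis unfolding tM by simp
    qed
    have "t powr M * (t powr (- ?n) * (\<integral>x. \<Phi> x \<partial>lborel)) \<le> C * (t powr (p + p * b) * (t powr (- ?n) * (\<integral>x. \<Psi> x \<partial>lborel)))"
      using c unfolding e1 e2 using integral_dilation[OF t, of \<Phi>] integral_dilation[OF t, of \<Psi>] by simp
    then have le: "(\<mu> powr (p - 1) * t powr (- M) * t powr ?n) * (t powr M * (t powr (- ?n) * (\<integral>x. \<Phi> x \<partial>lborel)))
      \<le> (\<mu> powr (p - 1) * t powr (- M) * t powr ?n) * (C * (t powr (p + p * b) * (t powr (- ?n) * (\<integral>x. \<Psi> x \<partial>lborel))))"
      by (intro mult_left_mono) auto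
    have tn: "t powr ?n * t powr (- ?n) = 1" using t by (simp flip: powr_add)
    have tp: "\<mu> powr (p - 1) * t powr (- M) * t powr (p + p * b) = 1"
    proof -
      have "- M + (p + p * b) = \<delta> * (p - 1)" using rel by (simp add: algebra_simps)
      then have "t powr (- M) * t powr (p + p * b) = t powr (\<delta> * (p - 1))"
        by (simp only: powr_add[symmetric])
      also have "\<dots> = (t powr \<delta>) powr (p - 1)" by (simp add: powr_powr)
      finally have "\<mu> powr (p - 1) * t powr (- M) * t powr (p + p * b) = (\<mu> * t powr \<delta>) powr (p - 1)"
        by (simp add: powr_mult mult.assoc)
      then show ?thesis unfolding t\<delta> by simp
    qed
    have "(\<mu> powr (p - 1) * t powr (- M) * t powr ?n) * (t powr M * (t powr (- ?n) * (\<integral>x. \<Phi> x \<partial>lborel)))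
      = \<mu> powr (p - 1) * (\<integral>x. \<Phi> x \<partial>lborel) * (t powr M * t powr (- M)) * (t powr ?n * t powr (- ?n))"
      by (simp only: mult_ac)
    moreover have "(\<mu> powr (p - 1) * t powr (- M) * t powr ?n) * (C * (t powr (p + p * b) * (t powr (- ?n) * (\<integral>x. \<Psi> x \<partial>lborel))))
      = C * (\<integral>x. \<Psi> x \<partial>lborel) * (\<mu> powr (p - 1) * t powr (- M) * t powr (p + p * b)) * (t powr ?n * t powr (- ?n))"
      by (simp only: mult_ac)
    ultimately have "\<mu> powr (p - 1) * (\<integral>x. \<Phi> x \<partial>lborel) \<le> C * (\<integral>x. \<Psi> x \<partial>lborel)"
      using le by (simp only: tM tn tp mult_1_right)
    then show ?thesis unfolding \<Phi>_def \<Psi>_def by blast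
  qed
  note scaled = this
  show ?thesis
    apply (rule exI[of _ C], intro conjI C allI impI)
    subgoal premises h for v G r R \<mu>
      by (rule scaled[of v G r R \<mu>]) (use h in blast)+
    done
qed

section \<open>The deficit and its stability\<close>

text \<open>Multiplying \<open>u\<close> by the reciprocal of the extremal function turns \<open>\<nabla>u - Y\<close>, up to the same factor, into a gradient. Vanishing of \<open>u\<close> near the
  origin keeps the product continuously differentiable there, although \<open>\<bar>x\<bar>\<^bsup>\<delta>\<^esup>\<close> need not be.\<close>

lemma ground_state_derivative:
  fixes u :: "'a::euclidean_space \<Rightarrow> real" and \<mu> \<delta> :: real
  assumes \<delta>: "\<delta> > 0" and u': "\<And>x. (u has_derivative (\<lambda>h. G x \<bullet> h)) (at x)" and G: "continuous_on UNIV G"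
    and r: "0 < r" and z: "\<And>x. norm x < r \<Longrightarrow> u x = 0"
  defines "v \<equiv> \<lambda>x. u x * exp (\<mu> / \<delta> * norm x powr \<delta>)"
    and "H \<equiv> \<lambda>x. exp (\<mu> / \<delta> * norm x powr \<delta>) *\<^sub>R (G x + (\<mu> * u x * norm x powr (\<delta> - 1)) *\<^sub>R sgn x)"
  shows "(v has_derivative (\<lambda>h. H x \<bullet> h)) (at x)" and "continuous_on UNIV H"
proof -
  have Gz: "G x = 0" if "norm x < r" for x
    by (rule gradient_eq_0_where_constant[OF u' open_ball[of 0 r]]) (use that z in auto)
  have Hz: "H x = 0" if "norm x < r" for x using Gz[OF that] z[OF that] by (simp add: H_def)
  show "(v has_derivative (\<lambda>h. H x \<bullet> h)) (at x)"
  proof (cases "x = 0")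
    case True
    have "((\<lambda>_. 0) has_derivative (\<lambda>h. H x \<bullet> h)) (at x)"
      using Hz[of 0] r True by simp
    then show ?thesis
      by (rule has_derivative_transform_within_open[OF _ open_ball[of 0 r]]) (use True r z in \<open>auto simp: v_def\<close>)
  next
    case False
    have "((\<lambda>\<rho>. exp (\<mu> / \<delta> * \<rho> powr \<delta>)) has_real_derivative \<mu> * norm x powr (\<delta> - 1) * exp (\<mu> / \<delta> * norm x powr \<delta>)) (at (norm x))"
      using False \<delta> by (auto intro!: derivative_eq_intros)
    from has_derivative_compose[OF has_derivative_norm[OF False] this[THEN has_field_derivative_imp_has_derivative]]
    have e: "((\<lambda>x. exp (\<mu> / \<delta> * norm x powr \<delta>)) has_derivative (\<lambda>h. \<mu> * norm x powr (\<delta> - 1) * exp (\<mu> / \<delta> * norm x powr \<delta>) * (h \<bullet> sgn x))) (at x)" .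
    show ?thesis
      unfolding v_def
      by (rule has_derivative_eq_rhs[OF has_derivative_mult[OF u' e]])
         (auto simp: H_def fun_eq_iff inner_simps inner_commute algebra_simps)
  qed
  have uc: "continuous_on UNIV u"
    using u' by (auto simp: continuous_on_eq_continuous_at intro: has_derivative_continuous)
  have "continuous_on (- {0}) H"
    unfolding H_def sgn_div_norm using \<delta>
    by (intro continuous_intros continuous_on_powr' continuous_on_subset[OF G] continuous_on_subset[OF uc]) auto
  moreover have "continuous_on (ball 0 r) H"
    by (rule continuous_on_eq[of _ "\<lambda>_. 0"]) (use Hz in auto)
  ultimately have "continuous_on (- {0} \<union> ball 0 r) H"
    by (intro continuous_on_open_Un) auto
  also have "- {0} \<union> ball 0 r = (UNIV :: 'a set)" using r by auto
  finally show "continuous_on UNIV H" .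
qed

text \<open>Uniform convexity at \<open>Y = - \<mu> w \<bar>x\<bar>\<^bsup>\<delta>-1\<^esup> x/\<bar>x\<bar>\<close>. Multiplication by \<open>\<bar>x\<bar>\<^bsup>-pb\<^esup>\<close> turns
  the powers of \<open>\<bar>x\<bar>\<close> in \<open>\<bar>Y\<bar>\<^bsup>p\<^esup>\<close> and in \<open>\<bar>Y\<bar>\<^bsup>p-2\<^esup> Y \<bullet> X\<close> into the exponents of \<open>B\<close> and \<open>D\<close>.\<close>

lemma ckn_remainder_pointwise:
  fixes x X :: "'a::euclidean_space" and w :: real
  assumes p: "p \<ge> 2" and l: "\<mu> > 0" and x: "x \<noteq> 0" and rel: "(p - 1) * \<delta> = p + p * b - M"
  shows "2 powr (1 - p) * (norm (X + (\<mu> * w * norm x powr (\<delta> - 1)) *\<^sub>R sgn x) powr p * norm x powr (- (p * b)))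
    \<le> norm X powr p * norm x powr (- (p * b)) + (p - 1) * \<mu> powr p * (\<bar>w\<bar> powr p * norm x powr (- (p * (b + 1 - \<delta>))))
      + p * \<mu> powr (p - 1) * (\<bar>w\<bar> powr (p - 2) * w * (X \<bullet> x) * norm x powr (- M))"
proof -
  define \<rho> where "\<rho> = norm x"
  have \<rho>: "\<rho> > 0" using x by (simp add: \<rho>_def)
  define Y where "Y = (- (\<mu> * w * \<rho> powr (\<delta> - 1))) *\<^sub>R sgn x"
  have nY: "norm Y = \<mu> * (\<bar>w\<bar> * \<rho> powr (\<delta> - 1))"
    using l x by (simp add: Y_def norm_sgn abs_mult)
  have 1: "norm Y powr p = \<mu> powr p * (\<bar>w\<bar> powr p * \<rho> powr (p * (\<delta> - 1)))"
    using l by (simp add: nY powr_mult powr_powr mult.commute[of p])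
  have 2: "norm Y powr (p - 2) * (Y \<bullet> X) = - (\<mu> powr (p - 1) * (\<bar>w\<bar> powr (p - 2) * w * (X \<bullet> x) * \<rho> powr ((p - 1) * \<delta> - p)))"
  proof -
    have "\<mu> powr (p - 2) * \<mu> = \<mu> powr (p - 1)"
      using l powr_add[of \<mu> "p - 2" 1] by simp
    moreover have "\<rho> powr ((\<delta> - 1) * (p - 2)) * \<rho> powr (\<delta> - 1) * \<rho> powr (- 1) = \<rho> powr ((p - 1) * \<delta> - p)"
      unfolding powr_add[symmetric] by (simp add: algebra_simps)
    moreover have "Y \<bullet> X = - (\<mu> * w * \<rho> powr (\<delta> - 1) * \<rho> powr (- 1) * (X \<bullet> x))"
      using \<rho> by (simp add: Y_def sgn_div_norm \<rho>_def[symmetric] powr_minus inner_commute)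
    moreover have "A * (B * R1) * - (k * w * R2 * R3 * c) = - (A * k * (B * w * c * (R1 * R2 * R3)))"
      for A B R1 R2 R3 k c :: real
      by (simp add: mult_ac)
    ultimately show ?thesis
      unfolding nY powr_mult powr_powr by metis
  qed
  have 3: "norm Y powr (p - 2) * (Y \<bullet> Y) = norm Y powr p"
  proof (cases "Y = 0")
    case False
    then have "norm Y powr p = norm Y powr (p - 2) * (norm Y)\<^sup>2"
      using powr_add[of "norm Y" "p - 2" 2] by simp
    then show ?thesis by (simp add: dot_square_norm)
  qed simp
  have "norm Y powr p + p * norm Y powr (p - 2) * (Y \<bullet> (X - Y)) + 2 powr (1 - p) * norm (X - Y) powr p \<le> norm X powr p"
    by (rule norm_powr_uniformly_convex[OF p])
  moreover have "p * norm Y powr (p - 2) * (Y \<bullet> (X - Y)) = p * (norm Y powr (p - 2) * (Y \<bullet> X)) - p * norm Y powr p"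
    by (simp only: inner_diff_right right_diff_distrib mult.assoc 3)
  moreover have "(p - 1) * norm Y powr p = p * norm Y powr p - norm Y powr p"
    by (simp add: left_diff_distrib)
  ultimately have "2 powr (1 - p) * norm (X - Y) powr p \<le> norm X powr p + (p - 1) * norm Y powr p - p * (norm Y powr (p - 2) * (Y \<bullet> X))"
    by linarith
  then have "2 powr (1 - p) * norm (X - Y) powr p * \<rho> powr (- (p * b))
    \<le> (norm X powr p + (p - 1) * norm Y powr p - p * (norm Y powr (p - 2) * (Y \<bullet> X))) * \<rho> powr (- (p * b))"
    by (intro mult_right_mono) auto
  also have "\<dots> = norm X powr p * \<rho> powr (- (p * b)) + (p - 1) * \<mu> powr p * (\<bar>w\<bar> powr p * (\<rho> powr (p * (\<delta> - 1)) * \<rho> powr (- (p * b))))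
      + p * \<mu> powr (p - 1) * (\<bar>w\<bar> powr (p - 2) * w * (X \<bullet> x) * (\<rho> powr ((p - 1) * \<delta> - p) * \<rho> powr (- (p * b))))"
    unfolding 1 2 by (simp add: algebra_simps)
  also have "\<rho> powr (p * (\<delta> - 1)) * \<rho> powr (- (p * b)) = \<rho> powr (- (p * (b + 1 - \<delta>)))"
    unfolding powr_add[symmetric] by (simp add: algebra_simps)
  also have "\<rho> powr ((p - 1) * \<delta> - p) * \<rho> powr (- (p * b)) = \<rho> powr (- M)"
    unfolding powr_add[symmetric] rel by (simp add: algebra_simps)
  finally show ?thesis
    by (simp add: Y_def \<rho>_def mult.assoc)
qed

lemma ckn_deficit_lower_bound:
  fixes u :: "'a::euclidean_space \<Rightarrow> real"
  assumes p: "p \<ge> 2" and l: "\<mu> > 0" and rel: "(p - 1) * \<delta> = p + p * b - M"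
    and u': "\<And>x. (u has_derivative (\<lambda>h. G x \<bullet> h)) (at x)" and G: "continuous_on UNIV G"
    and r: "0 < r" and z: "\<And>x. norm x < r \<or> R < norm x \<Longrightarrow> u x = 0"
  shows "2 powr (1 - p) * (\<integral>x. norm (G x + (\<mu> * u x * norm x powr (\<delta> - 1)) *\<^sub>R sgn x) powr p * norm x powr (- (p * b)) \<partial>lborel)
    \<le> (\<integral>x. norm (G x) powr p * norm x powr (- (p * b)) \<partial>lborel)
      + (p - 1) * \<mu> powr p * (\<integral>x. \<bar>u x\<bar> powr p * norm x powr (- (p * (b + 1 - \<delta>))) \<partial>lborel)
      - \<mu> powr (p - 1) * ((real DIM('a) - M) * (\<integral>x. \<bar>u x\<bar> powr p * norm x powr (- M) \<partial>lborel))"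
proof -
  let ?n = "real DIM('a)"
  have Gz: "G x = 0" if "norm x < r \<or> R < norm x" for x
  proof (rule gradient_eq_0_where_constant[OF u'])
    show "open ({x::'a. norm x < r} \<union> {x. R < norm x})"
      by (intro open_Un open_Collect_less continuous_intros)
  qed (use that z in auto)
  have uc: "continuous_on UNIV u"
    using u' by (auto simp: continuous_on_eq_continuous_at intro: has_derivative_continuous)
  have upc: "continuous_on S (\<lambda>x. \<bar>u x\<bar> powr (p - 2) * u x)" for S
    using continuous_on_compose2[OF continuous_abs_powr_times[OF p] uc] continuous_on_subset by auto
  note cont = continuous_intros continuous_on_powr' upc continuous_on_subset[OF G] continuous_on_subset[OF uc]
  let ?w = "\<lambda>q x::'a. norm x powr (- q)"
  have iA: "integrable lborel (\<lambda>x. norm (G x) powr p * ?w (p * b) x)"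
    by (rule integrable_vanish_outside_annulus[OF _ r, of _ R]) (use Gz p in \<open>auto intro!: cont\<close>)
  have iu: "integrable lborel (\<lambda>x. \<bar>u x\<bar> powr p * ?w q x)" for q
    by (rule integrable_vanish_outside_annulus[OF _ r, of _ R]) (use z p in \<open>auto intro!: cont\<close>)
  have iu': "integrable lborel (\<lambda>x. \<bar>u x\<bar> powr p * (norm x * (- M * norm x powr (- M - 1))))"
    by (rule integrable_vanish_outside_annulus[OF _ r, of _ R]) (use z p in \<open>auto intro!: cont\<close>)
  have iX: "integrable lborel (\<lambda>x. \<bar>u x\<bar> powr (p - 2) * u x * (G x \<bullet> x) * ?w M x)"
    by (rule integrable_vanish_outside_annulus[OF _ r, of _ R]) (use Gz p in \<open>auto intro!: cont\<close>)
  have iR: "integrable lborel (\<lambda>x. norm (G x + (\<mu> * u x * norm x powr (\<delta> - 1)) *\<^sub>R sgn x) powr p * ?w (p * b) x)"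
    unfolding sgn_div_norm
    by (rule integrable_vanish_outside_annulus[OF _ r, of _ R]) (use Gz z p in \<open>auto intro!: cont\<close>)
  have "(\<integral>x. \<bar>u x\<bar> powr p * (?n * ?w M x + norm x * (- M * norm x powr (- M - 1))) \<partial>lborel)
    = - p * (\<integral>x. \<bar>u x\<bar> powr (p - 2) * u x * (G x \<bullet> x) * ?w M x \<partial>lborel)"
    by (rule integral_radial_weight[OF p u' G _ _ iu iu' iX])
       (auto intro!: derivative_eq_intros cont)
  also have "(\<lambda>x::'a. \<bar>u x\<bar> powr p * (?n * ?w M x + norm x * (- M * norm x powr (- M - 1)))) = (\<lambda>x. (?n - M) * (\<bar>u x\<bar> powr p * ?w M x))"
  proof
    fix x :: 'a
    have "norm x * norm x powr (- M - 1) = ?w M x"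
      by (cases "x = 0") (simp_all add: powr_diff)
    then have w: "norm x * (- M * norm x powr (- M - 1)) = - M * ?w M x" by (simp add: mult.left_commute)
    show "\<bar>u x\<bar> powr p * (?n * ?w M x + norm x * (- M * norm x powr (- M - 1))) = (?n - M) * (\<bar>u x\<bar> powr p * ?w M x)"
      unfolding w by (simp add: algebra_simps)
  qed
  finally have id: "p * (\<integral>x. \<bar>u x\<bar> powr (p - 2) * u x * (G x \<bullet> x) * ?w M x \<partial>lborel) = - ((?n - M) * (\<integral>x. \<bar>u x\<bar> powr p * ?w M x \<partial>lborel))"
    by simp
  have "2 powr (1 - p) * (\<integral>x. norm (G x + (\<mu> * u x * norm x powr (\<delta> - 1)) *\<^sub>R sgn x) powr p * ?w (p * b) x \<partial>lborel)
    = (\<integral>x. 2 powr (1 - p) * (norm (G x + (\<mu> * u x * norm x powr (\<delta> - 1)) *\<^sub>R sgn x) powr p * ?w (p * b) x) \<partial>lborel)"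
    by simp
  also have "\<dots> \<le> (\<integral>x. norm (G x) powr p * ?w (p * b) x + (p - 1) * \<mu> powr p * (\<bar>u x\<bar> powr p * ?w (p * (b + 1 - \<delta>)) x)
      + p * \<mu> powr (p - 1) * (\<bar>u x\<bar> powr (p - 2) * u x * (G x \<bullet> x) * ?w M x) \<partial>lborel)"
  proof (rule integral_mono_AE)
    show "AE x in lborel. 2 powr (1 - p) * (norm (G x + (\<mu> * u x * norm x powr (\<delta> - 1)) *\<^sub>R sgn x) powr p * ?w (p * b) x)
      \<le> norm (G x) powr p * ?w (p * b) x + (p - 1) * \<mu> powr p * (\<bar>u x\<bar> powr p * ?w (p * (b + 1 - \<delta>)) x)
      + p * \<mu> powr (p - 1) * (\<bar>u x\<bar> powr (p - 2) * u x * (G x \<bullet> x) * ?w M x)"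
      using AE_lborel_singleton[of 0] by eventually_elim (rule ckn_remainder_pointwise[OF p l _ rel])
  qed (intro Bochner_Integration.integrable_add integrable_mult_right iA iu iX iR)+
  also have "\<dots> = (\<integral>x. norm (G x) powr p * ?w (p * b) x \<partial>lborel) + (p - 1) * \<mu> powr p * (\<integral>x. \<bar>u x\<bar> powr p * ?w (p * (b + 1 - \<delta>)) x \<partial>lborel)
     + \<mu> powr (p - 1) * (p * (\<integral>x. \<bar>u x\<bar> powr (p - 2) * u x * (G x \<bullet> x) * ?w M x \<partial>lborel))"
    using iA iu iX by (simp add: Bochner_Integration.integral_add Bochner_Integration.integrable_add integrable_mult_right)
  finally show ?thesis unfolding id by simp
qed

text \<open>The general form behind the theorem: the pair \<open>(\<delta>, M)\<close> replaces \<open>a\<close>, and \<open>u\<close> is merely continuously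
  differentiable. If \<open>A B = 0\<close> there is no optimal \<open>\<mu>\<close>; then letting \<open>\<mu>\<close> tend to \<open>0\<close> or to infinity in
  the additive inequality forces \<open>D = 0\<close>, and \<open>c = 0\<close> is a best constant.\<close>

lemma ckn_stability:
  fixes p b \<delta> M :: real
  assumes p: "p \<ge> 2" and b: "b \<ge> 0" and \<delta>: "\<delta> > 0" and M: "M < real DIM('a::euclidean_space)"
    and rel: "(p - 1) * \<delta> = p + p * b - M"
  shows "\<exists>C>0. \<forall>(u :: 'a \<Rightarrow> real) G r R.
    (\<forall>x. (u has_derivative (\<lambda>h. G x \<bullet> h)) (at x)) \<longrightarrow> continuous_on UNIV G \<longrightarrow> 0 < r \<longrightarrow>
    (\<forall>x. norm x < r \<or> R < norm x \<longrightarrow> u x = 0) \<longrightarrow>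
    (\<exists>c. \<exists>\<mu>>0. C * (\<integral>x. \<bar>u x - c * exp (- (\<mu> / \<delta>) * norm x powr \<delta>)\<bar> powr p * norm x powr (- M) \<partial>lborel)
      \<le> (\<integral>x. norm (G x) powr p * norm x powr (- (p * b)) \<partial>lborel) powr (1 / p)
          * (\<integral>x. \<bar>u x\<bar> powr p * norm x powr (- (p * (b + 1 - \<delta>))) \<partial>lborel) powr ((p - 1) / p)
        - (real DIM('a) - M) / p * (\<integral>x. \<bar>u x\<bar> powr p * norm x powr (- M) \<partial>lborel))"
proof -
  obtain C0 where C0: "C0 > 0" and wp: "\<forall>(v :: 'a \<Rightarrow> real) G r R \<mu>.
    (\<forall>x. (v has_derivative (\<lambda>h. G x \<bullet> h)) (at x)) \<longrightarrow> continuous_on UNIV G \<longrightarrow> 0 < r \<longrightarrow>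
    (\<forall>x. norm x < r \<or> R < norm x \<longrightarrow> v x = 0) \<longrightarrow> 0 < \<mu> \<longrightarrow>
    (\<exists>c. \<mu> powr (p - 1) * (\<integral>x. \<bar>v x - c\<bar> powr p * (norm x powr (- M) * exp (- (\<mu> * p / \<delta>) * norm x powr \<delta>)) \<partial>lborel)
      \<le> C0 * (\<integral>x. norm (G x) powr p * (norm x powr (- (p * b)) * exp (- (\<mu> * p / \<delta>) * norm x powr \<delta>)) \<partial>lborel))"
    using weighted_poincare_scaled[OF p b \<delta> M rel] by (elim exE conjE)
  define C where "C = 2 powr (1 - p) / (p * C0)"
  have C: "C > 0" using C0 p by (simp add: C_def)
  define L where "L = real DIM('a) - M"
  have L: "L > 0" using M by (simp add: L_def)
  have "\<exists>c. \<exists>\<mu>>0. C * (\<integral>x. \<bar>u x - c * exp (- (\<mu> / \<delta>) * norm x powr \<delta>)\<bar> powr p * norm x powr (- M) \<partial>lborel)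
      \<le> (\<integral>x. norm (G x) powr p * norm x powr (- (p * b)) \<partial>lborel) powr (1 / p)
          * (\<integral>x. \<bar>u x\<bar> powr p * norm x powr (- (p * (b + 1 - \<delta>))) \<partial>lborel) powr ((p - 1) / p)
        - L / p * (\<integral>x. \<bar>u x\<bar> powr p * norm x powr (- M) \<partial>lborel)"
    if u': "\<And>x. (u has_derivative (\<lambda>h. G x \<bullet> h)) (at x)" and G: "continuous_on UNIV G" and r: "0 < r"
      and z: "\<And>x. norm x < r \<or> R < norm x \<Longrightarrow> u x = 0" for u :: "'a \<Rightarrow> real" and G r R
  proof -
    define A where "A = (\<integral>x. norm (G x) powr p * norm x powr (- (p * b)) \<partial>lborel)"
    define B where "B = (\<integral>x. \<bar>u x\<bar> powr p * norm x powr (- (p * (b + 1 - \<delta>))) \<partial>lborel)"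
    define D where "D = (\<integral>x. \<bar>u x\<bar> powr p * norm x powr (- M) \<partial>lborel)"
    define I where "I = (\<lambda>c \<mu>. \<integral>x. \<bar>u x - c * exp (- (\<mu> / \<delta>) * norm x powr \<delta>)\<bar> powr p * norm x powr (- M) \<partial>lborel)"
    have nonneg: "A \<ge> 0" "B \<ge> 0" "D \<ge> 0" "I c \<mu> \<ge> 0" for c \<mu>
      unfolding A_def B_def D_def I_def by (intro integral_nonneg_AE; auto)+
    have key: "\<exists>c. p * C * \<mu> powr (p - 1) * I c \<mu> \<le> A + (p - 1) * \<mu> powr p * B - \<mu> powr (p - 1) * (L * D)" if \<mu>: "\<mu> > 0" for \<mu>
    proof -
      define v where "v = (\<lambda>x. u x * exp (\<mu> / \<delta> * norm x powr \<delta>))"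
      define Y where "Y = (\<lambda>x. G x + (\<mu> * u x * norm x powr (\<delta> - 1)) *\<^sub>R sgn x)"
      define H where "H = (\<lambda>x. exp (\<mu> / \<delta> * norm x powr \<delta>) *\<^sub>R Y x)"
      have v': "\<forall>x. (v has_derivative (\<lambda>h. H x \<bullet> h)) (at x)"
        unfolding v_def H_def Y_def by (intro allI, rule ground_state_derivative(1)[OF \<delta> u' G r]) (use z in auto)
      have H: "continuous_on UNIV H"
        unfolding H_def Y_def by (rule ground_state_derivative(2)[OF \<delta> u' G r]) (use z in auto)
      have vz: "\<forall>x. norm x < r \<or> R < norm x \<longrightarrow> v x = 0" using z by (simp add: v_def)
      obtain c where c: "\<mu> powr (p - 1) * (\<integral>x. \<bar>v x - c\<bar> powr p * (norm x powr (- M) * exp (- (\<mu> * p / \<delta>) * norm x powr \<delta>)) \<partial>lborel)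
        \<le> C0 * (\<integral>x. norm (H x) powr p * (norm x powr (- (p * b)) * exp (- (\<mu> * p / \<delta>) * norm x powr \<delta>)) \<partial>lborel)"
        using wp[THEN spec[of _ v], THEN spec[of _ H], THEN spec[of _ r], THEN spec[of _ R], THEN spec[of _ \<mu>],
            THEN mp, OF v', THEN mp, OF H, THEN mp, OF r, THEN mp, OF vz, THEN mp, OF \<mu>] by (elim exE)
      have ex: "exp (\<mu> / \<delta> * norm x powr \<delta>) powr p * exp (- (\<mu> * p / \<delta>) * norm x powr \<delta>) = 1" for x :: 'a
        by (simp add: exp_powr_real flip: exp_add)
      have e1: "\<bar>v x - c\<bar> powr p * (norm x powr (- M) * exp (- (\<mu> * p / \<delta>) * norm x powr \<delta>))
        = \<bar>u x - c * exp (- (\<mu> / \<delta>) * norm x powr \<delta>)\<bar> powr p * norm x powr (- M)" for x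
      proof -
        have "v x - c = exp (\<mu> / \<delta> * norm x powr \<delta>) * (u x - c * exp (- (\<mu> / \<delta>) * norm x powr \<delta>))"
          by (simp add: v_def algebra_simps flip: exp_add)
        then have "\<bar>v x - c\<bar> powr p = exp (\<mu> / \<delta> * norm x powr \<delta>) powr p * \<bar>u x - c * exp (- (\<mu> / \<delta>) * norm x powr \<delta>)\<bar> powr p"
          by (simp only: abs_mult abs_exp_cancel powr_mult)
        then have "\<bar>v x - c\<bar> powr p * (norm x powr (- M) * exp (- (\<mu> * p / \<delta>) * norm x powr \<delta>))
          = (exp (\<mu> / \<delta> * norm x powr \<delta>) powr p * exp (- (\<mu> * p / \<delta>) * norm x powr \<delta>)) * (\<bar>u x - c * exp (- (\<mu> / \<delta>) * norm x powr \<delta>)\<bar> powr p * norm x powr (- M))"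
          by (simp only: mult_ac)
        then show ?thesis unfolding ex by simp
      qed
      have e2: "norm (H x) powr p * (norm x powr (- (p * b)) * exp (- (\<mu> * p / \<delta>) * norm x powr \<delta>)) = norm (Y x) powr p * norm x powr (- (p * b))" for x
      proof -
        have "norm (H x) powr p = exp (\<mu> / \<delta> * norm x powr \<delta>) powr p * norm (Y x) powr p"
          by (simp only: H_def norm_scaleR abs_exp_cancel powr_mult)
        then have "norm (H x) powr p * (norm x powr (- (p * b)) * exp (- (\<mu> * p / \<delta>) * norm x powr \<delta>))
          = (exp (\<mu> / \<delta> * norm x powr \<delta>) powr p * exp (- (\<mu> * p / \<delta>) * norm x powr \<delta>)) * (norm (Y x) powr p * norm x powr (- (p * b)))"
          by (simp only: mult_ac)
        then show ?thesis unfolding ex by simp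
      qed
      have "2 powr (1 - p) / C0 * (\<mu> powr (p - 1) * I c \<mu>) \<le> 2 powr (1 - p) / C0 * (C0 * (\<integral>x. norm (Y x) powr p * norm x powr (- (p * b)) \<partial>lborel))"
        using c C0 unfolding e1 e2 I_def by (intro mult_left_mono) auto
      also have "\<dots> = 2 powr (1 - p) * (\<integral>x. norm (Y x) powr p * norm x powr (- (p * b)) \<partial>lborel)"
        using C0 by simp
      also have "\<dots> \<le> A + (p - 1) * \<mu> powr p * B - \<mu> powr (p - 1) * (L * D)"
        unfolding A_def B_def D_def L_def Y_def by (rule ckn_deficit_lower_bound[OF p \<mu> rel u' G r z])
      also have "2 powr (1 - p) / C0 * (\<mu> powr (p - 1) * I c \<mu>) = p * C * \<mu> powr (p - 1) * I c \<mu>"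
        using p C0 by (simp add: C_def)
      finally show ?thesis by blast
    qed
    \<comment> \<open>The inequality without remainder, used to exclude \<open>D > 0\<close> when \<open>A B = 0\<close>.\<close>
    have upper: "\<mu> powr (p - 1) * (L * D) \<le> A + (p - 1) * \<mu> powr p * B" if \<mu>: "\<mu> > 0" for \<mu>
    proof -
      obtain c where c: "p * C * \<mu> powr (p - 1) * I c \<mu> \<le> A + (p - 1) * \<mu> powr p * B - \<mu> powr (p - 1) * (L * D)"
        using key[OF \<mu>] by blast
      have "0 \<le> p * C * \<mu> powr (p - 1) * I c \<mu>" using p C nonneg(4) by (intro mult_nonneg_nonneg) auto
      with c show ?thesis by linarith
    qed
    show ?thesis
    proof (cases "A > 0 \<and> B > 0")
      case True
      define \<mu> where "\<mu> = (A / B) powr (1 / p)"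
      have \<mu>: "\<mu> > 0" using True by (simp add: \<mu>_def)
      have 1: "\<mu> powr p * B = A" using True p by (simp add: \<mu>_def powr_powr)
      have 2: "A = \<mu> powr (p - 1) * (A powr (1 / p) * B powr ((p - 1) / p))"
      proof -
        have "\<mu> powr (p - 1) = A powr ((p - 1) / p) / B powr ((p - 1) / p)"
          using True by (simp add: \<mu>_def powr_powr powr_divide)
        then have "\<mu> powr (p - 1) * (A powr (1 / p) * B powr ((p - 1) / p)) = A powr ((p - 1) / p) * A powr (1 / p)"
          using True by simp
        also have "\<dots> = A powr ((p - 1) / p + 1 / p)" by (rule powr_add[symmetric])
        also have "(p - 1) / p + 1 / p = 1" using p by (simp flip: add_divide_distrib)
        finally show ?thesis using True by simp
      qed
      obtain c where c: "p * C * \<mu> powr (p - 1) * I c \<mu> \<le> A + (p - 1) * \<mu> powr p * B - \<mu> powr (p - 1) * (L * D)"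
        using key[OF \<mu>] by blast
      also have "A + (p - 1) * \<mu> powr p * B - \<mu> powr (p - 1) * (L * D) = p * A - \<mu> powr (p - 1) * (L * D)"
        using 1 by (simp add: algebra_simps)
      also have "\<dots> = p * \<mu> powr (p - 1) * (A powr (1 / p) * B powr ((p - 1) / p) - L / p * D)"
        using p by (subst (1) 2) (simp add: right_diff_distrib)
      finally have "(p * \<mu> powr (p - 1)) * (C * I c \<mu>) \<le> (p * \<mu> powr (p - 1)) * (A powr (1 / p) * B powr ((p - 1) / p) - L / p * D)"
        by (simp add: mult_ac)
      then have "C * I c \<mu> \<le> A powr (1 / p) * B powr ((p - 1) / p) - L / p * D"
        by (rule mult_left_le_imp_le) (use p \<mu> in auto)
      then show ?thesis using \<mu> unfolding A_def B_def D_def I_def by blast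
    next
      case False
      have "D = 0"
      proof (rule ccontr)
        assume "D \<noteq> 0"
        then have LD: "L * D > 0" using nonneg(3) L by simp
        consider "A = 0" | "B = 0" using False nonneg(1,2) by linarith
        then show False
        proof cases
          case 1
          \<comment> \<open>Small enough for \<open>(p - 1) B \<mu> < L D\<close>.\<close>
          define \<mu> where "\<mu> = L * D / ((p - 1) * B + 1)"
          have den: "(p - 1) * B + 1 > 0" using p nonneg(2) by (intro add_nonneg_pos mult_nonneg_nonneg) auto
          have \<mu>: "\<mu> > 0" using LD den by (simp add: \<mu>_def)
          have "\<mu> powr p = \<mu> powr (p - 1) * \<mu>" using \<mu> powr_add[of \<mu> "p - 1" 1] by simp
          then have "\<mu> powr (p - 1) * (L * D) \<le> \<mu> powr (p - 1) * ((p - 1) * B * \<mu>)"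
            using upper[OF \<mu>] 1 by (simp add: mult_ac)
          then have "L * D \<le> (p - 1) * B * \<mu>" using \<mu> by simp
          also have "\<dots> < ((p - 1) * B + 1) * \<mu>" using \<mu> by (simp add: algebra_simps)
          also have "\<dots> = L * D" using den by (simp add: \<mu>_def)
          finally show False by simp
        next
          case 2
          \<comment> \<open>Large enough for \<open>\<mu>\<^bsup>p-1\<^esup> L D > A\<close>.\<close>
          define q where "q = (A + 1) / (L * D)"
          have q: "q > 0" unfolding q_def using LD nonneg(1) by (intro divide_pos_pos) auto
          define \<mu> where "\<mu> = q powr (1 / (p - 1))"
          have \<mu>: "\<mu> > 0" using q by (simp add: \<mu>_def)
          have "\<mu> powr (p - 1) = q" using p q by (simp add: \<mu>_def powr_powr)
          moreover have "L * D \<noteq> 0" using LD by linarith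
          ultimately have "\<mu> powr (p - 1) * (L * D) = A + 1" by (simp add: q_def)
          then show False using upper[OF \<mu>] 2 by simp
        qed
      qed
      moreover have "I 0 1 = D" by (simp add: I_def D_def)
      moreover have "A powr (1 / p) * B powr ((p - 1) / p) = 0" using False nonneg(1,2) by auto
      ultimately have "C * I 0 1 \<le> A powr (1 / p) * B powr ((p - 1) / p) - L / p * D" by simp
      then show ?thesis unfolding A_def B_def D_def I_def using zero_less_one by blast
    qed
  qed
  note stable = this[unfolded L_def]
  show ?thesis
    apply (rule exI[of _ C], intro conjI C allI impI)
    subgoal premises h for u G r R
      by (rule stable[of u G r R]) (use h in blast)+
    done
qed

text \<open>A test function vanishes on a whole ball around the origin, so its partial derivatives there are those of \<open>0\<close>
  and \<open>grad u\<close> is a continuous gradient on the whole space.\<close>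

lemma test_function_gradient:
  fixes u :: "real ^ 'n::finite \<Rightarrow> real"
  assumes u: "u \<in> test_functions (- {0})"
  obtains r R where "0 < r" "\<And>x. norm x < r \<or> R < norm x \<Longrightarrow> u x = 0"
    "\<And>x. (u has_derivative (\<lambda>h. grad u x \<bullet> h)) (at x)" "continuous_on UNIV (grad u)"
proof -
  have cpt: "compact (supp u)" and sub: "supp u \<subseteq> - {0}" and sm: "smooth_on (- {0}) u"
    using u by (auto simp: test_functions_def)
  have out: "u x = 0" if "x \<notin> supp u" for x
    using that closure_subset[of "{x. u x \<noteq> 0}"] by (auto simp: supp_def)
  have "open (- supp u)" "0 \<in> - supp u"
    using compact_imp_closed[OF cpt] sub by auto
  then obtain r where r: "r > 0" "ball 0 r \<subseteq> - supp u"
    using open_contains_ball by blast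
  obtain R where R: "\<And>x. x \<in> supp u \<Longrightarrow> norm x \<le> R"
    using compact_imp_bounded[OF cpt] by (auto simp: bounded_iff)
  have z: "u x = 0" if "norm x < r \<or> R < norm x" for x
    using that r(2) R[of x] by (intro out) auto
  have "Ck_on (Suc 0) (- {0}) u" using sm by (simp add: smooth_on_def)
  then have dif: "\<And>x. x \<noteq> 0 \<Longrightarrow> u differentiable (at x)"
    and pc: "\<And>i. continuous_on (- {0}) (partial_deriv i u)" by auto
  have d0: "(u has_derivative (\<lambda>h. 0)) (at x)" if "norm x < r" for x
  proof -
    have "((\<lambda>_. 0) has_derivative (\<lambda>h. 0)) (at x)" by simp
    then show ?thesis
      by (rule has_derivative_transform_within_open[OF _ open_ball[of 0 r]]) (use that z in auto)
  qed
  have dif: "u differentiable (at x)" for x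
  proof (cases "x = 0")
    case True
    then have "(u has_derivative (\<lambda>h. 0)) (at x)" using r(1) by (intro d0) simp
    then show ?thesis by (rule differentiableI)
  qed (rule dif)
  have grad: "(u has_derivative (\<lambda>h. grad u x \<bullet> h)) (at x)" for x
  proof -
    have d: "(u has_derivative frechet_derivative u (at x)) (at x)"
      using dif frechet_derivative_works by blast
    then have lin: "linear (frechet_derivative u (at x))" by (rule has_derivative_linear)
    have "frechet_derivative u (at x) h = grad u x \<bullet> h" for h
    proof -
      have "frechet_derivative u (at x) h = frechet_derivative u (at x) (\<Sum>i\<in>UNIV. (h $ i) *\<^sub>R axis i 1)"
        using basis_expansion[of h] by (simp add: scalar_mult_eq_scaleR)
      also have "\<dots> = (\<Sum>i\<in>UNIV. h $ i * partial_deriv i u x)"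
        by (simp add: linear_sum[OF lin] linear_cmul[OF lin] partial_deriv_def)
      also have "\<dots> = grad u x \<bullet> h" by (simp add: grad_def inner_vec_def mult.commute)
      finally show ?thesis .
    qed
    then have "frechet_derivative u (at x) = (\<lambda>h. grad u x \<bullet> h)" by (rule ext)
    with d show ?thesis by simp
  qed
  have "grad u x = 0" if "norm x < r" for x
    by (rule gradient_eq_0_where_constant[OF grad open_ball[of 0 r]]) (use that z in auto)
  then have "continuous_on (ball 0 r) (grad u)"
    by (subst continuous_on_cong[of _ _ _ "\<lambda>_. 0"]) auto
  moreover have "continuous_on (- {0}) (grad u)"
  proof -
    have "grad u = (\<lambda>x. \<chi> i. partial_deriv i u x)" by (simp add: grad_def fun_eq_iff)
    then show ?thesis using continuous_on_vec_lambda[OF pc] by simp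
  qed
  ultimately have "continuous_on (- {0} \<union> ball 0 r) (grad u)"
    by (intro continuous_on_open_Un) auto
  also have "- {0} \<union> ball 0 r = (UNIV :: (real ^ 'n) set)" using r(1) by auto
  finally have cont: "continuous_on UNIV (grad u)" .
  show ?thesis
    by (rule that[of r R]) (fact r(1) z grad cont)+
qed

theorem theorem1p9:
  fixes p a b N :: real
  defines "N \<equiv> real CARD('n::finite)"
  assumes "p \<ge> 2"
    and "0 \<le> b" and "b < (N - p) / p"
    and "a \<le> N * b / (N - p)"
    and "(p - 1) * a + b + 1 = p * b * N / (N - p)"
  shows "\<exists>C>0. \<forall>u \<in> test_functions (- {0 :: real ^ 'n}).
    (LINT x|lborel. norm (grad u x) powr p / norm x powr (p * b)) powr (1 / p)
      * (LINT x|lborel. \<bar>u x\<bar> powr p / norm x powr (p * a)) powr ((p - 1) / p)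
      - (N - 1 - (p - 1) * a - b) / p
        * (LINT x|lborel. \<bar>u x\<bar> powr p / norm x powr ((p - 1) * a + b + 1))
    \<ge> C * (INF (c, l) \<in> (UNIV :: real set) \<times> {0<..}.
        LINT x|lborel. \<bar>u x - c * exp (- (l / (b + 1 - a)) * norm x powr (b + 1 - a))\<bar> powr p
          / norm x powr ((p - 1) * a + b + 1))"
proof -
  note p = assms(2) and b = assms(3)
  define M where "M = (p - 1) * a + b + 1"
  define \<delta> where "\<delta> = b + 1 - a"
  have "0 < (N - p) / p" using assms(3,4) by linarith
  then have Np: "N > p" using p by (simp add: zero_less_divide_iff)
  have pb: "p * b < N - p" using assms(4) p by (simp add: less_divide_eq mult.commute)
  have MN: "M * (N - p) = p * b * N"
    using assms(6) Np by (simp add: M_def)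
  have "p * b * N < (N - p) * N" using pb Np p by (intro mult_strict_right_mono) auto
  then have "M * (N - p) < N * (N - p)" unfolding MN by (simp add: mult.commute)
  then have M: "M < real DIM(real ^ 'n)" using Np by (simp add: N_def)
  \<comment> \<open>The definitions of \<open>M\<close> and \<open>\<delta>\<close> give this identity; the hypothesis that fixes \<open>a\<close> is used for \<open>M < N\<close> and \<open>\<delta> > 0\<close>.\<close>
  have rel: "(p - 1) * \<delta> = p + p * b - M"
    by (simp add: M_def \<delta>_def algebra_simps)
  have "(p + p * b - M) * (N - p) = p * (N - p - p * b)"
    using MN by (simp add: algebra_simps)
  also have "\<dots> > 0" using pb p by (intro mult_pos_pos) auto
  finally have "(p - 1) * \<delta> > 0" unfolding rel using Np by (simp add: zero_less_mult_iff)
  then have \<delta>: "\<delta> > 0" using p by (simp add: zero_less_mult_iff)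
  have N: "real DIM(real ^ 'n) = N" by (simp add: N_def)
  have a: "b + 1 - \<delta> = a" by (simp add: \<delta>_def)
  obtain C where C: "C > 0" and st: "\<forall>(u :: real ^ 'n \<Rightarrow> real) G r R.
    (\<forall>x. (u has_derivative (\<lambda>h. G x \<bullet> h)) (at x)) \<longrightarrow> continuous_on UNIV G \<longrightarrow> 0 < r \<longrightarrow>
    (\<forall>x. norm x < r \<or> R < norm x \<longrightarrow> u x = 0) \<longrightarrow>
    (\<exists>c. \<exists>\<mu>>0. C * (\<integral>x. \<bar>u x - c * exp (- (\<mu> / \<delta>) * norm x powr \<delta>)\<bar> powr p * norm x powr (- M) \<partial>lborel)
      \<le> (\<integral>x. norm (G x) powr p * norm x powr (- (p * b)) \<partial>lborel) powr (1 / p)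
          * (\<integral>x. \<bar>u x\<bar> powr p * norm x powr (- (p * a)) \<partial>lborel) powr ((p - 1) / p)
        - (N - M) / p * (\<integral>x. \<bar>u x\<bar> powr p * norm x powr (- M) \<partial>lborel))"
    using ckn_stability[OF p b \<delta> M rel] unfolding a N by (elim exE conjE)
  show ?thesis
  proof (rule exI[of _ C], intro conjI C ballI)
    fix u :: "real ^ 'n \<Rightarrow> real" assume "u \<in> test_functions (- {0})"
    then obtain r R where r: "0 < r" and z: "\<forall>x. norm x < r \<or> R < norm x \<longrightarrow> u x = 0"
      and u': "\<forall>x. (u has_derivative (\<lambda>h. grad u x \<bullet> h)) (at x)" and g: "continuous_on UNIV (grad u)"
      by (rule test_function_gradient) blast
    from st[THEN spec[of _ u], THEN spec[of _ "grad u"], THEN spec[of _ r], THEN spec[of _ R],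
        THEN mp, OF u', THEN mp, OF g, THEN mp, OF r, THEN mp, OF z] obtain c \<mu> where \<mu>: "\<mu> > 0"
      and le: "C * (\<integral>x. \<bar>u x - c * exp (- (\<mu> / \<delta>) * norm x powr \<delta>)\<bar> powr p * norm x powr (- M) \<partial>lborel)
      \<le> (\<integral>x. norm (grad u x) powr p * norm x powr (- (p * b)) \<partial>lborel) powr (1 / p)
          * (\<integral>x. \<bar>u x\<bar> powr p * norm x powr (- (p * a)) \<partial>lborel) powr ((p - 1) / p)
        - (N - M) / p * (\<integral>x. \<bar>u x\<bar> powr p * norm x powr (- M) \<partial>lborel)"
      by blast
    define I where "I = (\<lambda>(c, l). LINT x|lborel. \<bar>u x - c * exp (- (l / \<delta>) * norm x powr \<delta>)\<bar> powr p * norm x powr (- M))"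
    have "(INF cl \<in> (UNIV :: real set) \<times> {0<..}. I cl) \<le> I (c, \<mu>)"
    proof (rule cINF_lower)
      show "bdd_below (I ` (UNIV \<times> {0<..}))"
        by (rule bdd_belowI[of _ 0]) (auto simp: I_def intro!: integral_nonneg_AE)
    qed (use \<mu> in auto)
    then have "C * (INF cl \<in> (UNIV :: real set) \<times> {0<..}. I cl) \<le> C * I (c, \<mu>)"
      using C by (intro mult_left_mono) auto
    also have "I (c, \<mu>) = (\<integral>x. \<bar>u x - c * exp (- (\<mu> / \<delta>) * norm x powr \<delta>)\<bar> powr p * norm x powr (- M) \<partial>lborel)"
      by (simp add: I_def)
    also note le
    finally have bound: "C * (INF cl \<in> (UNIV :: real set) \<times> {0<..}. I cl)
      \<le> (\<integral>x. norm (grad u x) powr p * norm x powr (- (p * b)) \<partial>lborel) powr (1 / p)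
          * (\<integral>x. \<bar>u x\<bar> powr p * norm x powr (- (p * a)) \<partial>lborel) powr ((p - 1) / p)
        - (N - M) / p * (\<integral>x. \<bar>u x\<bar> powr p * norm x powr (- M) \<partial>lborel)" .
    have NM: "N - 1 - (p - 1) * a - b = N - M" by (simp add: M_def)
    have div: "t / norm x powr q = t * norm x powr (- q)" for t q and x :: "real ^ 'n"
      by (simp add: powr_minus divide_inverse)
    show "C * (INF (c, l) \<in> (UNIV :: real set) \<times> {0<..}.
        LINT x|lborel. \<bar>u x - c * exp (- (l / (b + 1 - a)) * norm x powr (b + 1 - a))\<bar> powr p
          / norm x powr ((p - 1) * a + b + 1))
      \<le> (LINT x|lborel. norm (grad u x) powr p / norm x powr (p * b)) powr (1 / p)
      * (LINT x|lborel. \<bar>u x\<bar> powr p / norm x powr (p * a)) powr ((p - 1) / p)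
      - (N - 1 - (p - 1) * a - b) / p
        * (LINT x|lborel. \<bar>u x\<bar> powr p / norm x powr ((p - 1) * a + b + 1))"
      using bound unfolding I_def NM M_def[symmetric] \<delta>_def[symmetric] div .
  qed
qed

end
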